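(* Let $\mathbb W$, $C$ and $G$ be as in the context. Then $\operatorname{Inn}(\mathbb W)C$ is a normal subgroup of $\operatorname{Aut}(\mathbb W)$, $G$ is a subgroup with $\operatorname{Inn}(\mathbb W)C\cap G=1$, and $\operatorname{Aut}(\mathbb W)=\operatorname{Inn}(\mathbb W)C\,G$; that is, $$\operatorname{Aut}(\mathbb W)=\big(\operatorname{Inn}(\mathbb W)C\big)\rtimes G.$$
   Context: Fix an integer $n\ge 3$, pairwise distinct odd integers $m_1,\dots,m_l\ge 3$ and positive integers $k_1,\dots,k_l$ with $k_1+\cdots+k_l=n-1$. Partition $\{2,\dots,n\}$ into consecutive blocks $A_1=\{2,\dots,k_1+1\}$, $A_2=\{k_1+2,\dots,k_1+k_2+1\}$, …, $A_l$ (of sizes $k_1,\dots,k_l$), and put $t_i=m_j$ for $i\in A_j$. The star group is $\mathbb W=\langle w_1,\dots,w_n\mid w_j^2=1\ (1\le j\le n),\ (w_1w_i)^{t_i}=1\ (2\le i\le n)\rangle$. For $2\le i\le n$ and $1\le k<t_i$ with $\gcd(k,t_i)=1$, $\theta_i^k$ is the automorphism of $\mathbb W$ with $\theta_i^k(w_j)=w_j$ for $j\ne i$ and $\theta_i^k(w_i)=w_1(w_1w_i)^k$. Let $C_i=\langle\theta_i^k : 1\le k<t_i,\ \gcd(k,t_i)=1\rangle\cong \operatorname{U}_{t_i}$ and $C=C_2\times\cdots\times C_n\le\operatorname{Aut}(\mathbb W)$. $G$ is the group of graph automorphisms: the automorphisms $\tilde\alpha$ of $\mathbb W$ with $\tilde\alpha(w_1)=w_1$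 and $\tilde\alpha(w_i)=w_{\alpha(i)}$ ($2\le i\le n$), where $\alpha$ ranges over permutations of $\{2,\dots,n\}$ with $\alpha(A_j)=A_j$ for all $j$; $G\cong S_{k_1}\times\cdots\times S_{k_l}$. $\operatorname{Inn}(\mathbb W)$ is the group of inner automorphisms. *)

theory Defs
  imports "HOL-Algebra.Algebra"
begin

text \<open>Blocks are 0-indexed: block ks j = A_(j+1), for j < length ks.\<close>
definition block :: "nat list \<Rightarrow> nat \<Rightarrow> nat set" where
  "block ks j = {2 + sum_list (take j ks) .. 1 + sum_list (take (Suc j) ks)}"

definition label :: "nat list \<Rightarrow> nat list \<Rightarrow> nat \<Rightarrow> nat" where
  "label ks ms i = ms ! (THE j. j < length ks \<and> i \<in> block ks j)"

text \<open>Words over the generators 1..n (generator j stands for w_j; since all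
generators are involutions, the inverse of a word is its reverse).
wrel n t is the congruence on words generated by the defining relators.\<close>
inductive wrel :: "nat \<Rightarrow> (nat \<Rightarrow> nat) \<Rightarrow> nat list \<Rightarrow> nat list \<Rightarrow> bool"
  for n :: nat and t :: "nat \<Rightarrow> nat" where
  refl: "xs \<in> lists {1..n} \<Longrightarrow> wrel n t xs xs"
| sym: "wrel n t xs ys \<Longrightarrow> wrel n t ys xs"
| trans: "wrel n t xs ys \<Longrightarrow> wrel n t ys zs \<Longrightarrow> wrel n t xs zs"
| invol: "j \<in> {1..n} \<Longrightarrow> wrel n t [j, j] []"
| star: "i \<in> {2..n} \<Longrightarrow> wrel n t (concat (replicate (t i) [1, i])) []"
| cong: "wrel n t xs ys \<Longrightarrow> us \<in> lists {1..n} \<Longrightarrow> vs \<in> lists {1..n} \<Longrightarrow>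
         wrel n t (us @ xs @ vs) (us @ ys @ vs)"

definition wcls :: "nat \<Rightarrow> (nat \<Rightarrow> nat) \<Rightarrow> nat list \<Rightarrow> nat list set" where
  "wcls n t w = {v. wrel n t v w}"

definition StarGroup :: "nat \<Rightarrow> (nat \<Rightarrow> nat) \<Rightarrow> nat list set monoid" where
  "StarGroup n t =
    \<lparr>carrier = {wcls n t w | w. w \<in> lists {1..n}},
     monoid.mult = (\<lambda>a b. wcls n t ((SOME x. x \<in> a) @ (SOME y. y \<in> b))),
     one = wcls n t []\<rparr>"

text \<open>The endomorphism of the star group induced by sending generator w_j
to the word f j (restricted to the carrier, as automorphisms in AutoGroup are).\<close>
definition subst_map :: "nat \<Rightarrow> (nat \<Rightarrow> nat) \<Rightarrow> (nat \<Rightarrow> nat list) \<Rightarrow> nat list set \<Rightarrow> nat list set" where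
  "subst_map n t f = (\<lambda>A \<in> carrier (StarGroup n t). wcls n t (concat (map f (SOME w. w \<in> A))))"

definition theta :: "nat \<Rightarrow> (nat \<Rightarrow> nat) \<Rightarrow> nat \<Rightarrow> nat \<Rightarrow> nat list set \<Rightarrow> nat list set" where
  "theta n t i k = subst_map n t (\<lambda>j. if j = i then 1 # concat (replicate k [1, i]) else [j])"

definition graph_aut :: "nat \<Rightarrow> (nat \<Rightarrow> nat) \<Rightarrow> (nat \<Rightarrow> nat) \<Rightarrow> nat list set \<Rightarrow> nat list set" where
  "graph_aut n t \<alpha> = subst_map n t (\<lambda>j. if j = 1 then [1] else [\<alpha> j])"

definition inner_auts :: "('a, 'b) monoid_scheme \<Rightarrow> ('a \<Rightarrow> 'a) set" where
  "inner_auts H = {(\<lambda>x \<in> carrier H. g \<otimes>\<^bsub>H\<^esub> x \<otimes>\<^bsub>H\<^esub> inv\<^bsub>H\<^esub> g) | g. g \<in> carrier H}"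

text \<open>C = C_2 \<times> ... \<times> C_n as a subgroup of Aut(W): generated by all theta_i^k.\<close>
definition Csub :: "nat \<Rightarrow> (nat \<Rightarrow> nat) \<Rightarrow> (nat list set \<Rightarrow> nat list set) set" where
  "Csub n t = generate (AutoGroup (StarGroup n t))
     {theta n t i k | i k. i \<in> {2..n} \<and> 1 \<le> k \<and> k < t i \<and> coprime k (t i)}"

definition Gsub :: "nat \<Rightarrow> nat list \<Rightarrow> nat list \<Rightarrow> (nat list set \<Rightarrow> nat list set) set" where
  "Gsub n ks ms = {graph_aut n (label ks ms) \<alpha> | \<alpha>.
      bij_betw \<alpha> {2..n} {2..n} \<and> (\<forall>j < length ks. \<alpha> ` block ks j = block ks j)}"

end

theory Submission
  imports Defs
begin

text \<open>
  With \<open>w\<close> for $w_1$ and \<open>a i\<close> for the rotation $w_1 w_i$, the star group is the semidirect product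
  of the free product of the cyclic groups generated by the \<open>a i\<close> with the group of order two generated
  by \<open>w\<close>, which inverts every \<open>a i\<close>.  In terms of reduced words in the free product, an element
  inverted by \<open>w\<close> is a palindrome.  Since all orders are odd, this shows that every involution is
  conjugate to \<open>w\<close>, and that an element of odd order inverted by \<open>w\<close> is a power of a single \<open>a j\<close>,
  because the powers of a longer palindrome remain reduced.  Hence an automorphism, after an inner
  correction, fixes \<open>w\<close> and sends each \<open>a i\<close> to a power of some \<open>a j\<close>.  The resulting permutation of
  the indices depends homomorphically on the automorphism and preserves the orders \<open>t i\<close>; the kernel
  of this homomorphism is Inn(W) C, and the graph automorphisms split it.
\<close>

subsection \<open>Palindromes\<close>

text \<open>The presentation yields equalities only, whereas the argument has to tell elements
  apart; that is the purpose of the normal forms. Palindromes arise because two operations act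
  differently on a reduced word \<open>v\<close>: conjugation by \<open>w\<close> gives
  \<open>evl (map neg v)\<close>, inversion gives \<open>evl (rev (map neg v))\<close>. Both words
  are reduced, so equality of the elements forces \<open>rev v = v\<close>. Oddness of the orders
  enters repeatedly: \<open>neg\<close> fixes no letter, which keeps involutions out of the free
  product; 2 is invertible modulo \<open>t i\<close>, so that the middle letter of a palindrome is
  absorbed by a conjugation; the square of a nontrivial power of \<open>a i\<close> is nontrivial,
  which keeps the powers of long palindromes reduced. The inner correction of an automorphism is not
  unique. The index permutation is therefore defined through conjugates of powers of the
  \<open>a j\<close>, which makes it independent of that choice and compatible with
  composition.\<close>

text \<open>In even length the two middle entries are mirror images, hence equal, but they are also
  adjacent.\<close>

lemma palindrome_odd_length:
  assumes "distinct_adj u" "rev u = u" "u \<noteq> []"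
  shows "odd (length u)"
proof
  assume "even (length u)"
  then obtain m where m: "length u = 2 * m" by blast
  then have "m > 0" using assms(3) by (cases m) auto
  then have "u ! (m - 1) = u ! m"
    using rev_nth[of "m - 1" u] m assms(2) by (simp add: mult_2)
  then show False
    using distinct_adj_nth[OF assms(1), of "m - 1"] \<open>m > 0\<close> m by simp
qed

lemma palindrome_cases:
  assumes "rev u = u"
  obtains "u = []" | c where "u = [c]" | c v where "u = c # v @ [c]" "rev v = v"
proof (cases u)
  case (Cons c u')
  note u = Cons
  show ?thesis
  proof (cases u' rule: rev_exhaust)
    case Nil
    then show ?thesis using u that(2) by simp
  next
    case (snoc v d)
    have uv: "u = c # v @ [d]" using u snoc by simp
    have "rev (c # v @ [d]) = c # v @ [d]" using assms by (simp only: uv)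
    then have "d # (rev v @ [c]) = c # (v @ [d])" by (simp only: rev.simps rev_append append.simps append_assoc)
    then have "d = c" and v: "rev v = v" by (metis list.inject append1_eq_conv)+
    with uv have "u = c # v @ [c]" by (simp only:)
    from that(3)[OF this v] show ?thesis .
  qed
qed (rule that(1))

subsection \<open>The star group and its homomorphisms\<close>

text \<open>Blocks are absent here: the structure theory is phrased in the numbers
  \<open>t i\<close> alone, and the blocks come back at the end as the level sets of
  \<open>label\<close>.\<close>

locale odd_star_group =
  fixes n :: nat and t :: "nat \<Rightarrow> nat"
  assumes n_pos: "n \<ge> 1"
    and t_odd: "i \<in> {2..n} \<Longrightarrow> odd (t i)"
    and t_ge3: "i \<in> {2..n} \<Longrightarrow> t i \<ge> 3"
begin

declare One_nat_def [simp del]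

abbreviation "W \<equiv> StarGroup n t"
definition "L = lists {1..n}"
abbreviation "cl \<equiv> wcls n t"

lemma L_simps [simp]:
  "[] \<in> L" "x # xs \<in> L \<longleftrightarrow> x \<in> {1..n} \<and> xs \<in> L" "xs @ ys \<in> L \<longleftrightarrow> xs \<in> L \<and> ys \<in> L"
  "rev xs \<in> L \<longleftrightarrow> xs \<in> L"
  by (auto simp: L_def)

lemma concat_replicate_lists: "xs \<in> L \<Longrightarrow> concat (replicate k xs) \<in> L"
  by (induction k) auto

lemma wrel_refl: "xs \<in> L \<Longrightarrow> wrel n t xs xs"
  unfolding L_def by (rule wrel.refl)

lemma wrel_L: "wrel n t xs ys \<Longrightarrow> xs \<in> L \<and> ys \<in> L"
  by (induction rule: wrel.induct) (auto simp: concat_replicate_lists simp flip: L_def)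

lemma cl_eq_iff: "xs \<in> L \<Longrightarrow> cl xs = cl ys \<longleftrightarrow> wrel n t xs ys"
  unfolding wcls_def L_def using wrel.refl wrel.sym wrel.trans by blast

lemma wrel_append:
  assumes "wrel n t xs xs'" "wrel n t ys ys'" shows "wrel n t (xs @ ys) (xs' @ ys')"
proof -
  have "wrel n t ([] @ xs @ ys) ([] @ xs' @ ys)"
    using assms wrel_L by (intro wrel.cong) (auto simp flip: L_def)
  moreover have "wrel n t (xs' @ ys @ []) (xs' @ ys' @ [])"
    using assms wrel_L by (intro wrel.cong) (auto simp flip: L_def)
  ultimately show ?thesis
    by (auto intro: wrel.trans)
qed

text \<open>The product and \<open>subst_map\<close> pick representatives by Hilbert choice; since
  the pick is congruent to any given representative, both can be computed on arbitrary
  words.\<close>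

lemma some_wcls: "xs \<in> L \<Longrightarrow> wrel n t (SOME v. v \<in> cl xs) xs"
  unfolding wcls_def L_def by (metis (mono_tags, lifting) mem_Collect_eq someI_ex wrel.refl)

lemma carrier_W: "carrier W = cl ` L"
  by (auto simp: StarGroup_def L_def)

lemma cl_closed [simp, intro]: "xs \<in> L \<Longrightarrow> cl xs \<in> carrier W"
  by (auto simp: carrier_W)

lemma one_W: "\<one>\<^bsub>W\<^esub> = cl []"
  by (simp add: StarGroup_def)

lemma mult_W: "xs \<in> L \<Longrightarrow> ys \<in> L \<Longrightarrow> cl xs \<otimes>\<^bsub>W\<^esub> cl ys = cl (xs @ ys)"
proof -
  assume a: "xs \<in> L" "ys \<in> L"
  have r: "wrel n t ((SOME v. v \<in> cl xs) @ (SOME v. v \<in> cl ys)) (xs @ ys)"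
    using a by (intro wrel_append some_wcls)
  then show ?thesis
    using cl_eq_iff wrel_L[OF r] by (simp add: StarGroup_def)
qed

lemma rev_wrel: "xs \<in> L \<Longrightarrow> wrel n t (rev xs @ xs) []"
proof (induction xs)
  case Nil
  then show ?case by (simp add: wrel.refl flip: L_def)
next
  case (Cons x xs)
  then have "wrel n t (rev xs @ [x, x] @ xs) (rev xs @ [] @ xs)"
    by (intro wrel.cong wrel.invol) (auto simp flip: L_def)
  with Cons show ?case
    by (auto intro: wrel.trans)
qed

lemma group_W: "group W"
proof (rule groupI)
  fix x assume "x \<in> carrier W"
  then obtain xs where xs: "xs \<in> L" "x = cl xs" by (auto simp: carrier_W)
  have rx: "rev xs \<in> L" using xs by simp
  have "rev xs @ xs \<in> L" using rx xs by auto
  then have "cl (rev xs) \<otimes>\<^bsub>W\<^esub> x = \<one>\<^bsub>W\<^esub>"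
    using xs rx rev_wrel[OF xs(1)] cl_eq_iff[of "rev xs @ xs" "[]"] by (simp add: one_W mult_W)
  then show "\<exists>y\<in>carrier W. y \<otimes>\<^bsub>W\<^esub> x = \<one>\<^bsub>W\<^esub>" using rx cl_closed by blast
qed (auto simp: carrier_W one_W mult_W)

sublocale W: group W by (rule group_W)

lemma cl_Cons: "x \<in> {1..n} \<Longrightarrow> xs \<in> L \<Longrightarrow> cl (x # xs) = cl [x] \<otimes>\<^bsub>W\<^esub> cl xs"
  by (subst mult_W) auto

lemma cl_replicate: "xs \<in> L \<Longrightarrow> cl (concat (replicate k xs)) = cl xs [^]\<^bsub>W\<^esub> k"
proof (induction k)
  case (Suc k)
  then have "cl (concat (replicate (Suc k) xs)) = cl xs \<otimes>\<^bsub>W\<^esub> cl xs [^]\<^bsub>W\<^esub> k"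
    by (simp add: concat_replicate_lists flip: mult_W)
  then show ?case using Suc by (simp only: W.nat_pow_Suc2 cl_closed)
qed (simp add: one_W)

definition w where "w = cl [1]"
definition a where "a i = cl [1, i]"

lemma w_closed [simp, intro]: "w \<in> carrier W"
  using n_pos by (auto simp: w_def)

lemma a_closed [simp, intro]: "i \<in> {2..n} \<Longrightarrow> a i \<in> carrier W"
  by (auto simp: a_def)

lemma gen_involution: "j \<in> {1..n} \<Longrightarrow> cl [j] \<otimes>\<^bsub>W\<^esub> cl [j] = \<one>\<^bsub>W\<^esub>"
  using wrel.invol[of j n t] cl_eq_iff[of "[j, j]" "[]"] by (simp add: mult_W one_W)

lemma w_w [simp]: "w \<otimes>\<^bsub>W\<^esub> w = \<one>\<^bsub>W\<^esub>"
  using gen_involution[of 1] n_pos by (simp add: w_def)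

lemma inv_w [simp]: "inv\<^bsub>W\<^esub> w = w"
  by (rule W.inv_equality) auto

lemma w_w_cancel [simp]: "x \<in> carrier W \<Longrightarrow> w \<otimes>\<^bsub>W\<^esub> (w \<otimes>\<^bsub>W\<^esub> x) = x"
  by (simp flip: W.m_assoc)

lemma gen_eq: "i \<in> {2..n} \<Longrightarrow> cl [i] = w \<otimes>\<^bsub>W\<^esub> a i"
  using cl_Cons[of 1 "[i]"] by (auto simp: a_def simp flip: w_def)

lemma a_pow_t: "i \<in> {2..n} \<Longrightarrow> a i [^]\<^bsub>W\<^esub> t i = \<one>\<^bsub>W\<^esub>"
  using wrel.star[of i n t] cl_eq_iff[of "concat (replicate (t i) [1, i])" "[]"]
    concat_replicate_lists[of "[1, i]" "t i"] cl_replicate[of "[1, i]" "t i"]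
  by (simp add: one_W a_def)

lemma w_a_w: "i \<in> {2..n} \<Longrightarrow> w \<otimes>\<^bsub>W\<^esub> a i \<otimes>\<^bsub>W\<^esub> w = inv\<^bsub>W\<^esub> (a i)"
proof -
  assume i: "i \<in> {2..n}"
  have "(w \<otimes>\<^bsub>W\<^esub> a i \<otimes>\<^bsub>W\<^esub> w) \<otimes>\<^bsub>W\<^esub> a i = cl [i] \<otimes>\<^bsub>W\<^esub> cl [i]"
    using i by (simp add: gen_eq W.m_assoc)
  then show ?thesis
    using i gen_involution[of i] by (intro W.inv_equality[symmetric]) auto
qed

text \<open>Left multiplication by \<open>cl [i]\<close> is left multiplication by
  \<open>a i\<close> followed by one by \<open>w\<close>, see \<open>gen_eq\<close>. Words contain
  no inverses, so none occur in the cases.\<close>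

lemma W_induct [consumes 1, case_names one w a]:
  assumes x: "x \<in> carrier W"
    and "P \<one>\<^bsub>W\<^esub>"
    and Pw: "\<And>x. x \<in> carrier W \<Longrightarrow> P x \<Longrightarrow> P (w \<otimes>\<^bsub>W\<^esub> x)"
    and Pa: "\<And>i x. i \<in> {2..n} \<Longrightarrow> x \<in> carrier W \<Longrightarrow> P x \<Longrightarrow> P (a i \<otimes>\<^bsub>W\<^esub> x)"
  shows "P x"
proof -
  have "xs \<in> L \<Longrightarrow> P (cl xs)" for xs
  proof (induction xs)
    case Nil
    then show ?case using assms by (simp add: one_W)
  next
    case (Cons j xs)
    then have j: "j \<in> {1..n}" and xs: "xs \<in> L" and P: "P (cl xs)" by auto
    show ?case
    proof (cases "j = 1")
      case True
      then show ?thesis using Pw[OF _ P] xs cl_Cons[OF j xs] by (auto simp: w_def)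
    next
      case False
      then have j2: "j \<in> {2..n}" using j by auto
      have "P (w \<otimes>\<^bsub>W\<^esub> (a j \<otimes>\<^bsub>W\<^esub> cl xs))"
        using j2 xs P by (intro Pw Pa) auto
      then show ?thesis using cl_Cons[OF j xs] j2 xs by (simp add: gen_eq W.m_assoc)
    qed
  qed
  then show ?thesis using x by (auto simp: carrier_W)
qed

lemma hom_eqI:
  assumes f: "f \<in> hom W W" and g: "g \<in> hom W W" and "f w = g w"
    and "\<And>i. i \<in> {2..n} \<Longrightarrow> f (a i) = g (a i)" and x: "x \<in> carrier W"
  shows "f x = g x"
  using x
proof (induction rule: W_induct)
  case one
  then show ?case using hom_one[OF f group_W group_W] hom_one[OF g group_W group_W] by simp
qed (use assms in \<open>auto simp: hom_mult[OF f] hom_mult[OF g]\<close>)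

text \<open>The hypotheses \<open>inv\<close> and \<open>star\<close> say that the defining relators
  have trivial images; substitution then maps congruent words to congruent words, and the chosen
  representative does not matter.\<close>

lemma subst_map_apply:
  assumes f: "\<And>j. j \<in> {1..n} \<Longrightarrow> f j \<in> L"
    and inv: "\<And>j. j \<in> {1..n} \<Longrightarrow> cl (f j) \<otimes>\<^bsub>W\<^esub> cl (f j) = \<one>\<^bsub>W\<^esub>"
    and star: "\<And>i. i \<in> {2..n} \<Longrightarrow> (cl (f 1) \<otimes>\<^bsub>W\<^esub> cl (f i)) [^]\<^bsub>W\<^esub> t i = \<one>\<^bsub>W\<^esub>"
    and xs: "xs \<in> L"
  shows "subst_map n t f (cl xs) = cl (concat (map f xs))"
proof -
  have L: "concat (map f ys) \<in> L" if "ys \<in> L" for ys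
    using that f by (induction ys) auto
  have "wrel n t (concat (map f ys)) (concat (map f zs))" if "wrel n t ys zs" for ys zs
    using that
  proof (induction rule: wrel.induct)
    case (invol j)
    then show ?case
      using inv[of j] cl_eq_iff[of "f j @ f j" "[]"] f[of j] by (simp add: mult_W one_W)
  next
    case (star i)
    have *: "concat (map f (concat (replicate k [1, i]))) = concat (replicate k (f 1 @ f i))" for k
      by (induction k) auto
    have fL: "f 1 \<in> L" "f i \<in> L" using star f[of 1] f[of i] by auto
    then have "cl (concat (replicate (t i) (f 1 @ f i))) = cl []"
      using assms(3)[OF star] by (simp add: mult_W one_W cl_replicate)
    then show ?case
      using cl_eq_iff concat_replicate_lists[of "f 1 @ f i" "t i"] fL
      by (simp only: * L_simps list.map concat.simps)
  next
    case (cong xs ys us vs)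
    then show ?case
      using wrel.cong[OF cong.IH L[unfolded L_def] L[unfolded L_def]] cong.hyps by (simp flip: L_def)
  qed (auto intro: wrel_refl wrel.sym wrel.trans L simp flip: L_def)
  from this[OF some_wcls[OF xs]]
  have "cl (concat (map f (SOME v. v \<in> cl xs))) = cl (concat (map f xs))"
    using cl_eq_iff wrel_L by blast
  then show ?thesis using xs cl_closed[OF xs] by (simp add: subst_map_def)
qed

lemma subst_map_hom:
  assumes f: "\<And>j. j \<in> {1..n} \<Longrightarrow> f j \<in> L"
    and inv: "\<And>j. j \<in> {1..n} \<Longrightarrow> cl (f j) \<otimes>\<^bsub>W\<^esub> cl (f j) = \<one>\<^bsub>W\<^esub>"
    and star: "\<And>i. i \<in> {2..n} \<Longrightarrow> (cl (f 1) \<otimes>\<^bsub>W\<^esub> cl (f i)) [^]\<^bsub>W\<^esub> t i = \<one>\<^bsub>W\<^esub>"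
  shows "subst_map n t f \<in> hom W W"
proof -
  have L: "concat (map f ys) \<in> L" if "ys \<in> L" for ys
    using that f by (induction ys) auto
  have ap: "subst_map n t f (cl zs) = cl (concat (map f zs))" if "zs \<in> L" for zs
    by (rule subst_map_apply[OF assms that])
  show ?thesis
  proof (rule homI)
    fix x y assume "x \<in> carrier W" "y \<in> carrier W"
    then obtain xs ys where xy: "xs \<in> L" "ys \<in> L" "x = cl xs" "y = cl ys"
      by (auto simp: carrier_W)
    then have xyL: "xs @ ys \<in> L" by simp
    show "subst_map n t f (x \<otimes>\<^bsub>W\<^esub> y) = subst_map n t f x \<otimes>\<^bsub>W\<^esub> subst_map n t f y"
      using ap[OF xyL] xy by (simp add: ap mult_W L)
  qed (auto simp: carrier_W ap L)
qed

lemma subst_map_w: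
  assumes "\<And>j. j \<in> {1..n} \<Longrightarrow> f j \<in> L"
    and "\<And>j. j \<in> {1..n} \<Longrightarrow> cl (f j) \<otimes>\<^bsub>W\<^esub> cl (f j) = \<one>\<^bsub>W\<^esub>"
    and "\<And>i. i \<in> {2..n} \<Longrightarrow> (cl (f 1) \<otimes>\<^bsub>W\<^esub> cl (f i)) [^]\<^bsub>W\<^esub> t i = \<one>\<^bsub>W\<^esub>"
  shows "subst_map n t f w = cl (f 1)"
  using subst_map_apply[OF assms, of "[1]"] n_pos by (simp add: w_def)

lemma subst_map_a:
  assumes "\<And>j. j \<in> {1..n} \<Longrightarrow> f j \<in> L"
    and "\<And>j. j \<in> {1..n} \<Longrightarrow> cl (f j) \<otimes>\<^bsub>W\<^esub> cl (f j) = \<one>\<^bsub>W\<^esub>"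
    and "\<And>i. i \<in> {2..n} \<Longrightarrow> (cl (f 1) \<otimes>\<^bsub>W\<^esub> cl (f i)) [^]\<^bsub>W\<^esub> t i = \<one>\<^bsub>W\<^esub>"
    and "i \<in> {2..n}"
  shows "subst_map n t f (a i) = cl (f 1) \<otimes>\<^bsub>W\<^esub> cl (f i)"
  using subst_map_apply[OF assms(1-3), of "[1, i]"] assms(4) assms(1)[of 1] assms(1)[of i]
  by (auto simp: a_def mult_W)

subsection \<open>Normal forms\<close>

text \<open>A letter \<open>(i, k)\<close> stands for the \<open>k\<close>-th power of
  \<open>a i\<close>, and \<open>neg\<close> is the effect of conjugation by \<open>w\<close> on
  it.\<close>

definition neg :: "nat \<times> int \<Rightarrow> nat \<times> int" where
  "neg = (\<lambda>(i, k). (i, (- k) mod int (t i)))"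

definition letters :: "(nat \<times> int) set" where
  "letters = {(i, k). i \<in> {2..n} \<and> 0 < k \<and> k < int (t i)}"

text \<open>These are the normal forms of the free product: nontrivial syllables, neighbours from
  different cyclic factors.\<close>

definition red :: "(nat \<times> int) list \<Rightarrow> bool" where
  "red v \<longleftrightarrow> set v \<subseteq> letters \<and> distinct_adj (map fst v)"

fun ins :: "nat \<Rightarrow> int \<Rightarrow> (nat \<times> int) list \<Rightarrow> (nat \<times> int) list" where
  "ins i k [] = (if k mod int (t i) = 0 then [] else [(i, k mod int (t i))])"
| "ins i k ((j, l) # v) =
    (if j = i then (if (k + l) mod int (t i) = 0 then v else (i, (k + l) mod int (t i)) # v)
     else if k mod int (t i) = 0 then (j, l) # v else (i, k mod int (t i)) # (j, l) # v)"

lemma t_pos: "i \<in> {2..n} \<Longrightarrow> 0 < int (t i)"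
  using t_ge3[of i] by simp

lemma mod_in_letters: "i \<in> {2..n} \<Longrightarrow> k mod int (t i) \<noteq> 0 \<Longrightarrow> (i, k mod int (t i)) \<in> letters"
  using le_neq_trans[OF pos_mod_sign[OF t_pos, of i k]] pos_mod_bound[OF t_pos, of i k]
  unfolding letters_def by fastforce

lemma red_Nil [simp]: "red []"
  by (simp add: red_def)

lemma red_Cons: "red ((i, k) # v) \<longleftrightarrow> (i, k) \<in> letters \<and> red v \<and> (v = [] \<or> fst (hd v) \<noteq> i)"
  by (cases v) (auto simp: red_def)

lemma red_rev: "red (rev v) \<longleftrightarrow> red v"
  by (simp add: red_def flip: rev_map)

lemma red_ins: "i \<in> {2..n} \<Longrightarrow> red v \<Longrightarrow> red (ins i k v)"
  by (cases v) (auto simp: red_Cons mod_in_letters)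

lemma ins_0: "red v \<Longrightarrow> ins i 0 v = v"
  by (cases v) (auto simp: red_Cons letters_def zdvd_not_zless)

lemma ins_cong: "k mod int (t i) = k' mod int (t i) \<Longrightarrow> ins i k v = ins i k' v"
  using mod_add_cong[of k "int (t i)" k'] by (cases v) (force simp del: mod_add_left_eq)+

lemma ins_nonzero:
  "red v \<Longrightarrow> v = [] \<or> fst (hd v) \<noteq> i \<Longrightarrow> k mod int (t i) \<noteq> 0 \<Longrightarrow> ins i k v = (i, k mod int (t i)) # v"
  by (cases v) auto

lemma ins_zero: "red v \<Longrightarrow> k mod int (t i) = 0 \<Longrightarrow> ins i k v = v"
  using ins_cong[of k i 0 v] by (simp add: ins_0)

text \<open>This makes insertion an action of the additive group of integers. The delicate case is
  the cancellation of the first syllable: what remains does not start with \<open>i\<close>, so the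
  second insertion simply puts a new syllable in front.\<close>

lemma ins_ins:
  assumes v: "red v" shows "ins i k (ins i l v) = ins i (k + l) v"
proof (cases "v \<noteq> [] \<and> fst (hd v) = i")
  case True
  then obtain m u where vu: "v = (i, m) # u" by (cases v) auto
  have u: "red u" "u = [] \<or> fst (hd u) \<noteq> i" using v vu by (auto simp: red_Cons)
  show ?thesis
  proof (cases "(l + m) mod int (t i) = 0")
    case zero: True
    have *: "(k + l + m) mod int (t i) = k mod int (t i)"
      using zero by (metis add.assoc add.right_neutral mod_add_right_eq)
    show ?thesis
    proof (cases "k mod int (t i) = 0")
      case True
      then show ?thesis using zero vu u * by (simp add: ins_zero)
    next
      case False
      then show ?thesis using zero vu u * by (simp add: ins_nonzero)
    qed
  next
    case False
    have "(k + (l + m) mod int (t i)) mod int (t i) = (k + l + m) mod int (t i)"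
      by (simp add: mod_add_right_eq add.assoc)
    then show ?thesis using False vu by simp
  qed
next
  case False
  then have v': "v = [] \<or> fst (hd v) \<noteq> i" by auto
  show ?thesis
  proof (cases "l mod int (t i) = 0")
    case True
    then have "(k + l) mod int (t i) = k mod int (t i)"
      by (metis add.right_neutral mod_add_right_eq)
    then show ?thesis using v True ins_cong by (metis ins_zero)
  next
    case l: False
    have "(k + l mod int (t i)) mod int (t i) = (k + l) mod int (t i)"
      by (simp add: mod_add_right_eq)
    then show ?thesis
      using ins_nonzero[OF v v' l] v v' by (cases "(k + l) mod int (t i) = 0") (auto simp: ins_zero ins_nonzero)
  qed
qed

lemma fst_neg [simp]: "fst (neg x) = fst x"
  by (simp add: neg_def split: prod.split)

lemma map_fst_neg [simp]: "map fst (map neg v) = map fst v"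
  by simp

lemma neg_in_letters: "x \<in> letters \<Longrightarrow> neg x \<in> letters"
  by (auto simp: letters_def neg_def zmod_zminus1_eq_if)

lemma neg_neg: "x \<in> letters \<Longrightarrow> neg (neg x) = x"
  by (auto simp: letters_def neg_def mod_minus_eq)

text \<open>A fixed letter would be an element of order two in a cyclic group of odd order.\<close>

lemma neg_neq: "x \<in> letters \<Longrightarrow> neg x \<noteq> x"
proof
  assume x: "x \<in> letters" and eq: "neg x = x"
  obtain i k where ik: "x = (i, k)" by (cases x)
  then have "i \<in> {2..n}" "0 < k" "k < int (t i)" "(- k) mod int (t i) = k"
    using x eq by (auto simp: letters_def neg_def)
  then have "int (t i) = 2 * k" by (simp add: zmod_zminus1_eq_if)
  then show False using t_odd[OF \<open>i \<in> {2..n}\<close>]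
    by (metis dvd_triv_left even_of_nat)
qed

lemma red_neg: "red v \<Longrightarrow> red (map neg v)"
  by (auto simp: red_def neg_in_letters simp flip: map_map)

lemma map_neg_neg: "red v \<Longrightarrow> map neg (map neg v) = v"
  by (auto simp: red_def neg_neg intro!: map_idI)

lemma neg_mod: "neg (i, k mod int (t i)) = (i, (- k) mod int (t i))"
  by (simp add: neg_def mod_minus_eq)

lemma mod_minus_zero_iff: "(- k) mod (m::int) = 0 \<longleftrightarrow> k mod m = 0"
  by (simp add: mod_eq_0_iff_dvd)

lemma map_neg_ins: "map neg (ins i k v) = ins i (- k) (map neg v)"
proof (cases v)
  case Nil
  then show ?thesis by (simp add: neg_mod mod_minus_zero_iff)
next
  case (Cons x u)
  obtain j l where x: "x = (j, l)" by (cases x)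
  have 1: "((- l) mod int (t i) - k) mod int (t i) = (- (k + l)) mod int (t i)"
    using mod_diff_left_eq[of "- l" "int (t i)" k] by (simp only: minus_add diff_conv_add_uminus)
  show ?thesis
  proof (cases "j = i")
    case True
    have "neg (i, l) = (i, (- l) mod int (t i))" by (simp add: neg_def)
    then show ?thesis using Cons x True by (simp add: neg_mod 1 mod_minus_zero_iff del: minus_add_distrib)
  next
    case False
    have "neg (j, l) = (j, (- l) mod int (t j))" by (simp add: neg_def)
    then show ?thesis using Cons x False by (simp add: neg_mod mod_minus_zero_iff)
  qed
qed

text \<open>Van der Waerden's trick: the generators act on pairs \<open>(v, e)\<close> that stand for \<open>evl v\<close> times
  \<open>w\<close> to the power \<open>e\<close>, by the left multiplication one expects.  Invariance under the relators
  makes the normal form unique.\<close>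

definition gact :: "nat \<Rightarrow> (nat \<times> int) list \<times> bool \<Rightarrow> (nat \<times> int) list \<times> bool" where
  "gact j = (\<lambda>(v, e). (map neg (if j = 1 then v else ins j 1 v), \<not> e))"

definition act :: "nat list \<Rightarrow> (nat \<times> int) list \<times> bool \<Rightarrow> (nat \<times> int) list \<times> bool" where
  "act = foldr gact"

lemma act_Nil [simp]: "act [] s = s" and act_Cons [simp]: "act (j # xs) s = gact j (act xs s)"
  and act_append [simp]: "act (xs @ ys) s = act xs (act ys s)"
  by (simp_all add: act_def)

lemma red_gact: "j \<in> {1..n} \<Longrightarrow> red (fst s) \<Longrightarrow> red (fst (gact j s))"
  by (auto simp: gact_def split: prod.split intro!: red_neg red_ins)

lemma red_act: "xs \<in> L \<Longrightarrow> red (fst s) \<Longrightarrow> red (fst (act xs s))"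
  by (induction xs) (auto intro!: red_gact)

lemma gact_gact: "j \<in> {1..n} \<Longrightarrow> red (fst s) \<Longrightarrow> gact j (gact j s) = s"
  by (cases s) (auto simp: gact_def map_neg_ins map_neg_neg ins_ins ins_0 red_neg simp del: map_map)

text \<open>Generator \<open>i\<close> inserts 1 and then negates; generator 1 negates back and
  restores the flag. Each copy of \<open>[1, i]\<close> thus leaves a bare insertion of 1.\<close>

lemma act_rotation:
  assumes "i \<in> {2..n}" "red v"
  shows "act (concat (replicate k [1, i])) (v, e) = (ins i (int k) v, e)"
proof (induction k)
  case 0
  then show ?case using assms by (simp add: ins_0)
next
  case (Suc k)
  have "red (ins i (int k) v)" using assms by (rule red_ins)
  then show ?case using Suc assms
    by (auto simp: gact_def map_neg_neg red_ins ins_ins add.commute simp del: map_map)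
qed

lemma act_wrel: "wrel n t xs ys \<Longrightarrow> red (fst s) \<Longrightarrow> act xs s = act ys s"
proof (induction arbitrary: s rule: wrel.induct)
  case (invol j)
  then show ?case using gact_gact by simp
next
  case (star i)
  \<comment> \<open>The relator inserts \<open>t i\<close>, which is zero modulo
    \<open>t i\<close>.\<close>
  then show ?case
    using act_rotation[of i "fst s" "t i" "snd s"] ins_zero[of "fst s" "int (t i)" i] by simp
next
  case (cong xs ys us vs)
  have "red (fst (act vs s))" using cong red_act by (simp add: L_def)
  then show ?case using cong.IH by simp
qed auto

text \<open>Each generator flips the flag. Together with \<open>act_wrel\<close> this makes the
  parity of the word length an invariant of the group element.\<close>

lemma snd_act: "snd (act xs s) = (snd s \<noteq> odd (length xs))"
  by (induction xs) (auto simp: gact_def split: prod.split)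

section \<open>Values of letter lists in the star group\<close>

definition evl :: "(nat \<times> int) list \<Rightarrow> nat list set" where
  "evl v = foldr (\<lambda>(i, k) r. a i [^]\<^bsub>W\<^esub> k \<otimes>\<^bsub>W\<^esub> r) v \<one>\<^bsub>W\<^esub>"

lemma evl_Nil [simp]: "evl [] = \<one>\<^bsub>W\<^esub>"
  and evl_Cons [simp]: "evl ((i, k) # v) = a i [^]\<^bsub>W\<^esub> k \<otimes>\<^bsub>W\<^esub> evl v"
  by (simp_all add: evl_def)

lemma evl_closed: "set v \<subseteq> letters \<Longrightarrow> evl v \<in> carrier W"
  by (induction v) (auto simp: letters_def)

lemma evl_append:
  "set u \<subseteq> letters \<Longrightarrow> set v \<subseteq> letters \<Longrightarrow> evl (u @ v) = evl u \<otimes>\<^bsub>W\<^esub> evl v"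
proof (induction u)
  case Nil
  then show ?case using evl_closed by simp
next
  case (Cons x u)
  then show ?case by (cases x) (auto simp: W.m_assoc evl_closed letters_def)
qed

lemma a_pow_mod: "i \<in> {2..n} \<Longrightarrow> a i [^]\<^bsub>W\<^esub> (k mod int (t i)) = a i [^]\<^bsub>W\<^esub> k"
proof -
  assume i: "i \<in> {2..n}"
  have "a i [^]\<^bsub>W\<^esub> k = a i [^]\<^bsub>W\<^esub> (int (t i) * (k div int (t i)) + k mod int (t i))"
    by simp
  also have "\<dots> = (a i [^]\<^bsub>W\<^esub> int (t i)) [^]\<^bsub>W\<^esub> (k div int (t i)) \<otimes>\<^bsub>W\<^esub> a i [^]\<^bsub>W\<^esub> (k mod int (t i))"
    using i by (simp only: W.int_pow_mult W.int_pow_pow a_closed)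
  finally show ?thesis using i by (simp add: int_pow_int a_pow_t)
qed

lemma a_pow_zero: "i \<in> {2..n} \<Longrightarrow> k mod int (t i) = 0 \<Longrightarrow> a i [^]\<^bsub>W\<^esub> k = \<one>\<^bsub>W\<^esub>"
  using a_pow_mod[of i k] by simp

lemma evl_ins:
  assumes "i \<in> {2..n}" "set v \<subseteq> letters"
  shows "evl (ins i k v) = a i [^]\<^bsub>W\<^esub> k \<otimes>\<^bsub>W\<^esub> evl v"
proof (cases v)
  case Nil
  then show ?thesis using assms by (auto simp: a_pow_mod a_pow_zero)
next
  case (Cons x u)
  obtain j l where x: "x = (j, l)" by (cases x)
  have u: "evl u \<in> carrier W" and j: "j \<in> {2..n}"
    using assms Cons x by (auto simp: evl_closed letters_def)
  have "a i [^]\<^bsub>W\<^esub> k \<otimes>\<^bsub>W\<^esub> (a i [^]\<^bsub>W\<^esub> l \<otimes>\<^bsub>W\<^esub> evl u) = a i [^]\<^bsub>W\<^esub> (k + l) \<otimes>\<^bsub>W\<^esub> evl u"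
    using assms u by (simp add: W.int_pow_mult W.m_assoc)
  then show ?thesis using Cons x assms u j
    by (auto simp: a_pow_mod a_pow_zero)
qed

lemma w_a_pow: "i \<in> {2..n} \<Longrightarrow> w \<otimes>\<^bsub>W\<^esub> a i [^]\<^bsub>W\<^esub> (k::int) \<otimes>\<^bsub>W\<^esub> w = a i [^]\<^bsub>W\<^esub> (- k)"
proof -
  assume i: "i \<in> {2..n}"
  have hom: "(\<lambda>x. w \<otimes>\<^bsub>W\<^esub> x \<otimes>\<^bsub>W\<^esub> w) \<in> hom W W"
    by (rule homI) (auto simp: W.m_assoc)
  from hom_int_pow[OF hom a_closed[OF i] group_W group_W, of k]
  have "w \<otimes>\<^bsub>W\<^esub> a i [^]\<^bsub>W\<^esub> k \<otimes>\<^bsub>W\<^esub> w = (inv\<^bsub>W\<^esub> (a i)) [^]\<^bsub>W\<^esub> k"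
    using i by (simp add: w_a_w)
  then show ?thesis using i by (simp add: W.int_pow_inv W.int_pow_neg)
qed

lemma w_a_pow': "i \<in> {2..n} \<Longrightarrow> w \<otimes>\<^bsub>W\<^esub> a i [^]\<^bsub>W\<^esub> (k::int) = a i [^]\<^bsub>W\<^esub> (- k) \<otimes>\<^bsub>W\<^esub> w"
  using w_a_pow[of i k, symmetric] by (simp add: W.m_assoc)

lemma a_pow_neg_letter: "(i, k) \<in> letters \<Longrightarrow> a i [^]\<^bsub>W\<^esub> snd (neg (i, k)) = a i [^]\<^bsub>W\<^esub> (- k)"
  by (auto simp: neg_def letters_def a_pow_mod)

text \<open>Moving \<open>w\<close> through the product inverts every syllable but keeps the order
  of the syllables. Inversion, in \<open>inv_evl\<close>, also reverses the order; palindromes come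
  from comparing the two.\<close>

lemma w_evl: "set v \<subseteq> letters \<Longrightarrow> w \<otimes>\<^bsub>W\<^esub> evl v = evl (map neg v) \<otimes>\<^bsub>W\<^esub> w"
proof (induction v)
  case (Cons x v)
  obtain i k where x: "x = (i, k)" by (cases x)
  have ik: "(i, k) \<in> letters" and l: "set v \<subseteq> letters" "set (map neg v) \<subseteq> letters"
    using Cons.prems x neg_in_letters by auto
  then have i: "i \<in> {2..n}" and v: "evl v \<in> carrier W" "evl (map neg v) \<in> carrier W" "(i,k) \<in> letters"
    using evl_closed[OF l(1)] evl_closed[OF l(2)] by (simp_all add: letters_def)
  have n: "evl (neg (i, k) # u) = a i [^]\<^bsub>W\<^esub> (- k) \<otimes>\<^bsub>W\<^esub> evl u" for u
    using evl_Cons[of i "snd (neg (i, k))" u] a_pow_neg_letter[OF ik] by (simp add: neg_def)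
  have "w \<otimes>\<^bsub>W\<^esub> evl (x # v) = a i [^]\<^bsub>W\<^esub> (- k) \<otimes>\<^bsub>W\<^esub> (w \<otimes>\<^bsub>W\<^esub> evl v)"
    using i v x by (simp add: w_a_pow' flip: W.m_assoc)
  also have "\<dots> = evl (map neg (x # v)) \<otimes>\<^bsub>W\<^esub> w"
    using i v x Cons by (simp add: n W.m_assoc)
  finally show ?case .
qed simp

lemma inv_evl: "set v \<subseteq> letters \<Longrightarrow> inv\<^bsub>W\<^esub> (evl v) = evl (rev (map neg v))"
proof (induction v)
  case (Cons x v)
  obtain i k where x: "x = (i, k)" by (cases x)
  have v: "(i, k) \<in> letters" "neg (i, k) \<in> letters" "evl v \<in> carrier W" "set (rev (map neg v)) \<subseteq> letters"
    using Cons.prems x neg_in_letters by (auto intro: evl_closed)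
  then have i: "i \<in> {2..n}" by (simp add: letters_def)
  then have ai: "a i \<in> carrier W" ..
  have n: "neg (i, k) = (i, snd (neg (i, k)))" by (simp add: prod_eq_iff)
  have "evl [neg (i, k)] = a i [^]\<^bsub>W\<^esub> (- k)"
    using v W.int_pow_closed[OF ai] by (subst n) (simp add: a_pow_neg_letter)
  then show ?case
    using i v x Cons evl_append[of "rev (map neg v)" "[neg (i, k)]"]
    by (simp add: W.inv_mult_group W.int_pow_neg)
qed simp

section \<open>Existence and uniqueness of normal forms\<close>

definition nf :: "nat list set \<Rightarrow> (nat \<times> int) list \<times> bool" where
  "nf x = act (SOME xs. xs \<in> x) ([], False)"

lemma nf_cl: "xs \<in> L \<Longrightarrow> nf (cl xs) = act xs ([], False)"
  unfolding nf_def by (rule act_wrel[OF some_wcls]) auto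

lemma red_letters: "red v \<Longrightarrow> set v \<subseteq> letters"
  by (simp add: red_def)

text \<open>Existence: the orbit of the base point \<open>([], False)\<close> records left
  multiplication, and \<open>evl\<close> turns this record back into the element.\<close>

lemma cl_eq_evl_act:
  "xs \<in> L \<Longrightarrow> cl xs = evl (fst (act xs ([], False))) \<otimes>\<^bsub>W\<^esub> (if odd (length xs) then w else \<one>\<^bsub>W\<^esub>)"
proof (induction xs)
  case Nil
  then show ?case by (simp add: one_W)
next
  case (Cons j xs)
  let ?s = "act xs ([], False)"
  let ?e = "if odd (length xs) then w else \<one>\<^bsub>W\<^esub>"
  let ?e' = "if odd (length (j # xs)) then w else \<one>\<^bsub>W\<^esub>"
  have j: "j \<in> {1..n}" and xs: "xs \<in> L" using Cons by auto
  have r: "red (fst ?s)" using red_act[OF xs] by simp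
  note l = red_letters[OF r] red_letters[OF red_neg[OF r]]
  have e: "w \<otimes>\<^bsub>W\<^esub> ?e = ?e'" "?e \<in> carrier W" by auto
  have *: "w \<otimes>\<^bsub>W\<^esub> (evl v \<otimes>\<^bsub>W\<^esub> ?e) = evl (map neg v) \<otimes>\<^bsub>W\<^esub> ?e'" if "red v" for v
  proof -
    have c: "evl v \<in> carrier W" "evl (map neg v) \<in> carrier W"
      using that red_neg red_letters by (auto intro!: evl_closed simp del: set_map)
    have "w \<otimes>\<^bsub>W\<^esub> (evl v \<otimes>\<^bsub>W\<^esub> ?e) = evl (map neg v) \<otimes>\<^bsub>W\<^esub> (w \<otimes>\<^bsub>W\<^esub> ?e)"
      using c e(2) w_evl[OF red_letters[OF that]] by (simp only: W.m_assoc[symmetric] w_closed)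
    then show ?thesis by (simp only: e(1))
  qed
  show ?case
  proof (cases "j = 1")
    case True
    then have "cl (j # xs) = w \<otimes>\<^bsub>W\<^esub> (evl (fst ?s) \<otimes>\<^bsub>W\<^esub> ?e)"
      using cl_Cons[OF j xs] Cons.IH xs by (simp add: w_def)
    then show ?thesis using *[OF r] True by (simp add: gact_def split: prod.split)
  next
    case False
    then have j2: "j \<in> {2..n}" using j by auto
    have "cl (j # xs) = w \<otimes>\<^bsub>W\<^esub> (evl (ins j 1 (fst ?s)) \<otimes>\<^bsub>W\<^esub> ?e)"
      using cl_Cons[OF j xs] Cons.IH xs j2 l evl_closed[OF l(1)] e(2)
      by (simp add: gen_eq W.m_assoc evl_ins)
    then show ?thesis using *[OF red_ins[OF j2 r]] False
      by (simp add: gact_def split: prod.split)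
  qed
qed

lemma W_cases:
  assumes "x \<in> carrier W"
  obtains v where "red v" "x = evl v" | v where "red v" "x = evl v \<otimes>\<^bsub>W\<^esub> w"
proof -
  obtain xs where xs: "xs \<in> L" "x = cl xs" using assms by (auto simp: carrier_W)
  have r: "red (fst (act xs ([], False)))" using red_act[OF xs(1)] by simp
  show ?thesis
    using that[OF r] cl_eq_evl_act[OF xs(1)] evl_closed[OF red_letters[OF r]] xs(2)
    by (cases "odd (length xs)") auto
qed

text \<open>The converse direction, needed for uniqueness: some word for \<open>evl v\<close> leads
  from the empty list to \<open>v\<close> itself. The flag \<open>e\<close> is left free because
  \<open>nf_evl_w\<close> starts from \<open>True\<close>, after a final letter 1 has acted.\<close>

lemma evl_word:
  assumes "red v"
  obtains xs where "xs \<in> L" "cl xs = evl v" "\<And>e. act xs ([], e) = (v, e)"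
  using assms
proof (induction v arbitrary: thesis)
  case Nil
  show ?case by (rule Nil(1)[of "[]"]) (auto simp: one_W)
next
  case (Cons x v)
  obtain i k where x: "x = (i, k)" by (cases x)
  then have ik: "i \<in> {2..n}" "0 < k" "k < int (t i)" and v: "red v" "v = [] \<or> fst (hd v) \<noteq> i"
    using Cons.prems(2) by (auto simp: red_Cons letters_def)
  obtain xs where xs: "xs \<in> L" "cl xs = evl v" "\<And>e. act xs ([], e) = (v, e)"
    using Cons.IH[OF _ v(1)] by blast
  let ?r = "concat (replicate (nat k) [1, i])"
  have r: "?r \<in> L" using ik by (intro concat_replicate_lists) auto
  have "cl (?r @ xs) = a i [^]\<^bsub>W\<^esub> nat k \<otimes>\<^bsub>W\<^esub> evl v"
    using r xs ik cl_replicate[of "[1, i]" "nat k"] by (simp add: a_def flip: mult_W)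
  then have "cl (?r @ xs) = evl (x # v)"
    using ik x by (simp flip: int_pow_int)
  moreover have "act (?r @ xs) ([], e) = (x # v, e)" for e
    using xs(3) act_rotation[OF ik(1) v(1), of "nat k" e] ik x v by (simp add: ins_nonzero)
  ultimately show ?case using Cons.prems(1)[of "?r @ xs"] r xs by simp
qed

lemma nf_evl: "red v \<Longrightarrow> nf (evl v) = (v, False)"
  using evl_word[of v] nf_cl by metis

lemma nf_evl_w: "red v \<Longrightarrow> nf (evl v \<otimes>\<^bsub>W\<^esub> w) = (v, True)"
proof -
  assume v: "red v"
  obtain xs where xs: "xs \<in> L" "cl xs = evl v" "\<And>e. act xs ([], e) = (v, e)"
    using evl_word[OF v] by blast
  have "xs @ [1] \<in> L" using xs n_pos by simp
  then have "evl v \<otimes>\<^bsub>W\<^esub> w = cl (xs @ [1])" "nf (cl (xs @ [1])) = (v, True)"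
    using xs nf_cl[of "xs @ [1]"] mult_W[of xs "[1]"] by (simp_all add: gact_def w_def)
  then show ?thesis by simp
qed

lemma evl_inj: "red u \<Longrightarrow> red v \<Longrightarrow> evl u = evl v \<Longrightarrow> u = v"
  using nf_evl by (metis fst_conv)

text \<open>An odd power of a word of odd length has odd length and cannot be trivial, by the parity
  invariant; so no factor \<open>w\<close> is left over in the normal form.\<close>

lemma odd_order_evl:
  assumes x: "x \<in> carrier W" and m: "odd m" "x [^]\<^bsub>W\<^esub> (m::nat) = \<one>\<^bsub>W\<^esub>"
  obtains v where "red v" "x = evl v"
proof -
  obtain xs where xs: "xs \<in> L" "x = cl xs" using x by (auto simp: carrier_W)
  let ?ys = "concat (replicate m xs)"
  have L: "?ys \<in> L" using xs by (simp add: concat_replicate_lists)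
  have "wrel n t ?ys []"
    using m xs cl_eq_iff[OF L, of "[]"] by (simp add: cl_replicate one_W)
  then have "even (length ?ys)"
    using snd_act[of ?ys "([], False)"] act_wrel by (metis fst_conv act_Nil red_Nil snd_conv)
  moreover have "length ?ys = m * length xs" by (simp add: length_concat sum_list_replicate)
  ultimately have "even (length xs)" using m by simp
  then show ?thesis
    using that[of "fst (act xs ([], False))"] red_act[OF xs(1), of "([], False)"]
      cl_eq_evl_act[OF xs(1)] xs(2) evl_closed red_letters by simp
qed

text \<open>The relators bound the order of \<open>a i\<close> from above; that it is exactly
  \<open>t i\<close> comes from uniqueness of normal forms.\<close>

lemma a_pow_eq_one_iff: "i \<in> {2..n} \<Longrightarrow> a i [^]\<^bsub>W\<^esub> (k::int) = \<one>\<^bsub>W\<^esub> \<longleftrightarrow> int (t i) dvd k"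
proof
  assume i: "i \<in> {2..n}" and k: "a i [^]\<^bsub>W\<^esub> k = \<one>\<^bsub>W\<^esub>"
  show "int (t i) dvd k"
  proof (rule ccontr)
    assume "\<not> int (t i) dvd k"
    then have "red [(i, k mod int (t i))]"
      using i mod_in_letters by (auto simp: red_Cons mod_eq_0_iff_dvd)
    moreover have "evl [(i, k mod int (t i))] = evl []" using i k by (simp add: a_pow_mod)
    ultimately show False using evl_inj red_Nil by (metis list.distinct(1))
  qed
qed (simp add: a_pow_zero)

subsection \<open>Involutions and elements inverted by $w_1$\<close>

abbreviation conjg :: "nat list set \<Rightarrow> nat list set \<Rightarrow> nat list set" where
  "conjg g x \<equiv> g \<otimes>\<^bsub>W\<^esub> x \<otimes>\<^bsub>W\<^esub> inv\<^bsub>W\<^esub> g"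

lemma conj_mult: "g \<in> carrier W \<Longrightarrow> h \<in> carrier W \<Longrightarrow> x \<in> carrier W \<Longrightarrow> conjg g (conjg h x) = conjg (g \<otimes>\<^bsub>W\<^esub> h) x"
  by (simp add: W.m_assoc W.inv_mult_group)

lemma conj_hom: "g \<in> carrier W \<Longrightarrow> conjg g \<in> hom W W"
  by (rule homI) (simp_all add: W.m_assoc W.inv_solve_left)

text \<open>Moving \<open>inv (evl [c])\<close> past \<open>w\<close> turns it into
  \<open>evl [c]\<close>, so conjugation by \<open>evl [c]\<close> adds \<open>c\<close> at both
  ends of the palindrome. Peeling off ends leaves the empty word or one letter, and a single
  exponent can be halved.\<close>

lemma palindrome_w_conj:
  "set v \<subseteq> letters \<Longrightarrow> rev v = v \<Longrightarrow> \<exists>g\<in>carrier W. evl v \<otimes>\<^bsub>W\<^esub> w = conjg g w"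
proof (induction v rule: length_induct)
  case (1 v)
  show ?case
  proof (cases rule: palindrome_cases[OF 1(3)])
    case 1
    then show ?thesis by (intro bexI[of _ "\<one>\<^bsub>W\<^esub>"]) auto
  next
    case (2 c)
    obtain i k where c: "c = (i, k)" by (cases c)
    have i: "i \<in> {2..n}" using 1(2) 2 c by (auto simp: letters_def)
    note ai = a_closed[OF i]
    \<comment> \<open>\<open>h\<close> is the inverse of 2 modulo \<open>t i\<close>; it is an
      integer because \<open>t i\<close> is odd.\<close>
    define h where "h = (int (t i) + 1) div 2"
    have h: "2 * h = int (t i) + 1" unfolding h_def using t_odd[OF i] by (intro dvd_mult_div_cancel) simp
    let ?g = "a i [^]\<^bsub>W\<^esub> (k * h)"
    have g: "?g \<in> carrier W" using ai by (rule W.int_pow_closed)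
    have "k * h + k * h = k * (2 * h)" by simp
    then have *: "(k * h + k * h) mod int (t i) = k mod int (t i)" by (simp add: h distrib_left)
    have "conjg ?g w = ?g \<otimes>\<^bsub>W\<^esub> (w \<otimes>\<^bsub>W\<^esub> a i [^]\<^bsub>W\<^esub> (- (k * h)))"
      using g ai by (simp add: W.int_pow_neg W.m_assoc)
    also have "\<dots> = a i [^]\<^bsub>W\<^esub> (k * h + k * h) \<otimes>\<^bsub>W\<^esub> w"
      using g ai i by (simp only: W.int_pow_mult) (simp add: w_a_pow' W.m_assoc)
    also have "\<dots> = a i [^]\<^bsub>W\<^esub> k \<otimes>\<^bsub>W\<^esub> w"
      using a_pow_mod[OF i, of "k * h + k * h"] a_pow_mod[OF i, of k] * by simp
    finally show ?thesis using 2 c ai g by (intro bexI[of _ ?g]) simp_all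
  next
    case (3 c u)
    have l: "set u \<subseteq> letters" "c \<in> letters" using 1(2) 3 by auto
    then have c: "evl [c] \<in> carrier W" and u: "evl u \<in> carrier W" by (auto intro: evl_closed)
    obtain g where g: "g \<in> carrier W" "evl u \<otimes>\<^bsub>W\<^esub> w = conjg g w"
      using 1(1)[rule_format, of u] 3 l by auto
    have "w \<otimes>\<^bsub>W\<^esub> inv\<^bsub>W\<^esub> (evl [c]) = evl [c] \<otimes>\<^bsub>W\<^esub> w"
      using l w_evl[of "[neg c]"] by (simp add: inv_evl neg_in_letters neg_neg)
    then have "conjg (evl [c]) (evl u \<otimes>\<^bsub>W\<^esub> w) = evl [c] \<otimes>\<^bsub>W\<^esub> (evl u \<otimes>\<^bsub>W\<^esub> (evl [c] \<otimes>\<^bsub>W\<^esub> w))"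
      using c u by (simp add: W.m_assoc)
    also have "\<dots> = evl v \<otimes>\<^bsub>W\<^esub> w"
      using c u l 3 evl_append[of "[c]" "u @ [c]"] evl_append[of u "[c]"] by (simp add: W.m_assoc)
    finally show ?thesis
      using g c conj_mult[of "evl [c]" g w] by (intro bexI[of _ "evl [c] \<otimes>\<^bsub>W\<^esub> g"]) auto
  qed
qed

lemma involution_conj_w:
  assumes x: "x \<in> carrier W" "x \<otimes>\<^bsub>W\<^esub> x = \<one>\<^bsub>W\<^esub>" "x \<noteq> \<one>\<^bsub>W\<^esub>"
  obtains g where "g \<in> carrier W" "x = conjg g w"
  using x(1)
proof (cases rule: W_cases)
  case (1 v)
  have l: "set v \<subseteq> letters" using 1 by (simp add: red_letters)
  have "evl v = inv\<^bsub>W\<^esub> (evl v)" using x 1 by (metis W.inv_equality)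
  moreover have "red (rev (map neg v))"
    using red_neg[OF 1(1)] by (simp only: red_rev)
  ultimately have v: "rev (map neg v) = v" using 1 l by (metis evl_inj inv_evl)
  \<comment> \<open>\<open>neg\<close> keeps the indices, so they form a palindrome even though the
    exponents are negated.\<close>
  then have "rev (map fst v) = map fst v" by (metis map_fst_neg rev_map)
  moreover have "v \<noteq> []" using 1 x by force
  ultimately have "odd (length v)"
    using 1 palindrome_odd_length[of "map fst v"] by (simp add: red_def)
  then obtain m where m: "length v = 2 * m + 1" by (elim oddE)
  \<comment> \<open>The middle position is its own mirror image, so its letter would have to be
    fixed by \<open>neg\<close>.\<close>
  have "v ! m = neg (v ! m)"
    using rev_nth[of m "map neg v"] v m by simp
  moreover have "v ! m \<in> letters" using l m by (intro subsetD[OF l] nth_mem) simp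
  ultimately have False using neg_neq by metis
  then show ?thesis ..
next
  case (2 v)
  have l: "set v \<subseteq> letters" and l': "set (map neg v) \<subseteq> letters"
    using red_letters[OF 2(1)] red_letters[OF red_neg[OF 2(1)]] .
  note c = evl_closed[OF l] evl_closed[OF l']
  \<comment> \<open>The square of \<open>evl v\<close> times \<open>w\<close> contains
    \<open>evl v\<close> conjugated by \<open>w\<close>, that is
    \<open>evl (map neg v)\<close>.\<close>
  have "evl v \<otimes>\<^bsub>W\<^esub> evl (map neg v) = x \<otimes>\<^bsub>W\<^esub> x"
  proof -
    have "evl (map neg v) = w \<otimes>\<^bsub>W\<^esub> (evl v \<otimes>\<^bsub>W\<^esub> w)"
      using w_evl[OF l] c by (simp add: W.m_assoc flip: W.m_assoc) (simp add: W.m_assoc)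
    then show ?thesis using 2 c by (simp add: W.m_assoc)
  qed
  then have "evl (map neg v) = inv\<^bsub>W\<^esub> (evl v)" using x c by (metis W.inv_equality W.r_inv W.inv_inv)
  moreover have "red (rev (map neg v))"
    using red_neg[OF 2(1)] by (simp only: red_rev)
  ultimately have "map neg v = rev (map neg v)" using 2 l red_neg by (metis evl_inj inv_evl)
  then have "map neg (map neg v) = rev (map neg (map neg v))" by (metis rev_map)
  then have "rev v = v" using 2 by (simp only: map_neg_neg)
  then show ?thesis using palindrome_w_conj[OF l] that 2 by metis
qed

text \<open>Odd order removes the factor \<open>w\<close>, and comparing normal forms makes
  \<open>v\<close> a palindrome. One letter is the desired power; a palindrome with equal outer
  letters \<open>c\<close> around a nonempty core has infinite order.\<close>

lemma inverted_odd_order: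
  assumes x: "x \<in> carrier W" "x \<noteq> \<one>\<^bsub>W\<^esub>" and inv: "w \<otimes>\<^bsub>W\<^esub> x \<otimes>\<^bsub>W\<^esub> w = inv\<^bsub>W\<^esub> x"
    and m: "odd m" "x [^]\<^bsub>W\<^esub> (m::nat) = \<one>\<^bsub>W\<^esub>"
  obtains i k where "i \<in> {2..n}" "x = a i [^]\<^bsub>W\<^esub> (k::int)"
proof -
  obtain v where v: "red v" "x = evl v" using odd_order_evl[OF x(1) m] .
  have l: "set v \<subseteq> letters" and l': "set (map neg v) \<subseteq> letters"
    using red_letters[OF v(1)] red_letters[OF red_neg[OF v(1)]] .
  have "w \<otimes>\<^bsub>W\<^esub> evl v \<otimes>\<^bsub>W\<^esub> w = evl (map neg v)"
    using w_evl[OF l] evl_closed[OF l'] by (simp add: W.m_assoc)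
  then have "evl (map neg v) = evl (rev (map neg v))" using inv v l by (simp add: inv_evl)
  moreover have "red (rev (map neg v))"
    using red_neg[OF v(1)] by (simp only: red_rev)
  ultimately have "map neg v = rev (map neg v)" using v red_neg by (metis evl_inj)
  then have "map neg (map neg v) = rev (map neg (map neg v))" by (metis rev_map)
  then have pal: "rev v = v" using v by (simp only: map_neg_neg)
  then show ?thesis
  proof (cases rule: palindrome_cases)
    case 1
    then show ?thesis using x v by simp
  next
    case (2 c)
    then show ?thesis using that v l by (cases c) (auto simp: letters_def)
  next
    case (3 c u)
    obtain i k where c: "c = (i, k)" by (cases c)
    have ik: "i \<in> {2..n}" "0 < k" "k < int (t i)" using l 3 c by (auto simp: letters_def)
    note ai = a_closed[OF ik(1)]
    have "u \<noteq> []" using v(1) 3 by (auto simp: red_def)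
    then have ru: "red u" "u \<noteq> []" "fst (hd u) \<noteq> i" "fst (last u) \<noteq> i"
      using v(1) 3 c by (auto simp: red_def distinct_adj_append_iff distinct_adj_Cons hd_map last_map hd_append)
    \<comment> \<open>Since \<open>2 * k\<close> lies strictly between 0 and \<open>2 * t i\<close>,
      it could only equal \<open>t i\<close>, which is odd.\<close>
    have nd: "(2 * k) mod int (t i) \<noteq> 0"
    proof
      assume "(2 * k) mod int (t i) = 0"
      then obtain q where q: "2 * k = int (t i) * q" by (metis dvd_def mod_0_imp_dvd)
      have "0 < int (t i) * q" "int (t i) * q < int (t i) * 2" using ik q[symmetric] by simp_all
      then have "q = 1" using ik by (simp add: zero_less_mult_iff)
      then show False using q t_odd[OF ik(1)] by (metis dvd_triv_left even_of_nat mult.right_neutral)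
    qed
    define c2 where "c2 = (i, (2 * k) mod int (t i))"
    have c2: "c2 \<in> letters" "evl [c2] = evl [c] \<otimes>\<^bsub>W\<^esub> evl [c]"
      using mod_in_letters[OF ik(1) nd] ik ai a_pow_mod[OF ik(1), of "2 * k"] W.int_pow_mult[OF ai, of k k]
      by (simp_all add: c2_def c)
    have lu: "set u \<subseteq> letters" "c \<in> letters" using l 3 by auto
    \<comment> \<open>powers of \<open>x\<close> stay reduced, since \<open>t i\<close> is odd: only the outer letters merge, into \<open>c2\<close>\<close>
    have "\<exists>z. red (c # z @ [c]) \<and> z \<noteq> [] \<and> x [^]\<^bsub>W\<^esub> Suc r = evl (c # z @ [c])" for r
    proof (induction r)
      case 0
      then show ?case using v 3 ru x by (intro exI[of _ u]) simp
    next
      case (Suc r)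
      then obtain z where z: "red (c # z @ [c])" "z \<noteq> []" "x [^]\<^bsub>W\<^esub> Suc r = evl (c # z @ [c])" by blast
      have lz: "set z \<subseteq> letters" using z by (auto simp: red_def)
      \<comment> \<open>The last \<open>c\<close> of the old power meets the first \<open>c\<close>
        of the new factor \<open>x\<close>. Their merger \<open>c2\<close> is nontrivial, and its
        neighbours have other indices, so nothing further collapses.\<close>
      have "red (c # (z @ c2 # u) @ [c])"
        using z(1,2) ru v(1) 3 c c2(1)
        by (auto simp: red_def distinct_adj_append_iff distinct_adj_Cons hd_map last_map hd_append c2_def)
      moreover have "x [^]\<^bsub>W\<^esub> Suc (Suc r) = evl (c # (z @ c2 # u) @ [c])"
      proof -
        have cl: "evl [c] \<in> carrier W" "evl u \<in> carrier W" "evl z \<in> carrier W"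
          using lu lz by (auto intro: evl_closed)
        have "x [^]\<^bsub>W\<^esub> Suc (Suc r) = evl (c # z @ [c]) \<otimes>\<^bsub>W\<^esub> evl (c # u @ [c])"
          using z(3) v(2) 3 by simp
        also have "\<dots> = evl [c] \<otimes>\<^bsub>W\<^esub> (evl z \<otimes>\<^bsub>W\<^esub> (evl [c2] \<otimes>\<^bsub>W\<^esub> (evl u \<otimes>\<^bsub>W\<^esub> evl [c])))"
          using lu lz cl evl_append[of "[c]" "z @ [c]"] evl_append[of "[c]" "u @ [c]"]
            evl_append[of z "[c]"] evl_append[of u "[c]"] by (simp add: c2(2) W.m_assoc)
        also have "\<dots> = evl (c # (z @ c2 # u) @ [c])"
          using lu lz cl c2(1) evl_append[of "[c]" "z @ c2 # u @ [c]"] evl_append[of z "c2 # u @ [c]"]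
            evl_append[of "[c2]" "u @ [c]"] evl_append[of u "[c]"] by simp
        finally show ?thesis .
      qed
      ultimately show ?case by (intro exI[of _ "z @ c2 # u"]) simp
    qed
    moreover obtain r where "m = Suc r" using m by (cases m) auto
    ultimately obtain z where "red (c # z @ [c])" "evl (c # z @ [c]) = evl []"
      using m(2) by (metis evl_Nil)
    then show ?thesis using evl_inj red_Nil by (metis list.distinct(1))
  qed
qed

subsection \<open>The permutation induced by an automorphism\<close>

abbreviation "A \<equiv> AutoGroup W"
abbreviation "I \<equiv> {2..n}"

sublocale A: group A by (rule W.AutoGroup)

lemma carrier_A: "carrier A = hom W W \<inter> Bij (carrier W)"
  by (simp add: AutoGroup_def auto_def)

lemma A_hom: "\<phi> \<in> carrier A \<Longrightarrow> \<phi> \<in> hom W W"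
  by (simp add: carrier_A)

lemma A_group_hom: "\<phi> \<in> carrier A \<Longrightarrow> group_hom W W \<phi>"
  by (simp add: A_hom group_hom.intro group_hom_axioms.intro group_W)

lemma A_closed [simp, intro]: "\<phi> \<in> carrier A \<Longrightarrow> x \<in> carrier W \<Longrightarrow> \<phi> x \<in> carrier W"
  using A_hom by (rule hom_in_carrier)

lemma A_inj: "\<phi> \<in> carrier A \<Longrightarrow> inj_on \<phi> (carrier W)"
  by (simp add: carrier_A Bij_def bij_betw_def)

lemma A_apply: "\<phi> \<in> carrier A \<Longrightarrow> \<psi> \<in> carrier A \<Longrightarrow> x \<in> carrier W \<Longrightarrow> (\<phi> \<otimes>\<^bsub>A\<^esub> \<psi>) x = \<phi> (\<psi> x)"
  by (simp add: AutoGroup_def auto_def BijGroup_def compose_def)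

lemma A_one: "x \<in> carrier W \<Longrightarrow> \<one>\<^bsub>A\<^esub> x = x"
  by (simp add: AutoGroup_def BijGroup_def)

lemma A_inv_apply: "\<phi> \<in> carrier A \<Longrightarrow> x \<in> carrier W \<Longrightarrow> (inv\<^bsub>A\<^esub> \<phi>) (\<phi> x) = x"
  using A_apply[of "inv\<^bsub>A\<^esub> \<phi>" \<phi> x] by (simp add: A_one)

lemma A_eqI:
  assumes "\<phi> \<in> carrier A" "\<psi> \<in> carrier A" "\<phi> w = \<psi> w" "\<And>i. i \<in> I \<Longrightarrow> \<phi> (a i) = \<psi> (a i)"
  shows "\<phi> = \<psi>"
proof (rule extensionalityI)
  show "\<phi> \<in> extensional (carrier W)" "\<psi> \<in> extensional (carrier W)"
    using assms by (auto simp: carrier_A Bij_def)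
next
  fix x assume x: "x \<in> carrier W"
  show "\<phi> x = \<psi> x"
    by (rule hom_eqI[of \<phi> \<psi>]) (simp_all only: assms A_hom x)
qed

text \<open>Both composites with \<open>g\<close> are endomorphisms, so agreement with the identity
  on \<open>w\<close> and the \<open>a i\<close> already makes \<open>g\<close> a two-sided
  inverse.\<close>

lemma A_I:
  assumes f: "f \<in> hom W W" "f \<in> extensional (carrier W)" and g: "g \<in> hom W W"
    and "g (f w) = w" "\<And>i. i \<in> I \<Longrightarrow> g (f (a i)) = a i"
    and "f (g w) = w" "\<And>i. i \<in> I \<Longrightarrow> f (g (a i)) = a i"
  shows "f \<in> carrier A"
proof -
  have gf: "g \<circ> f \<in> hom W W" "f \<circ> g \<in> hom W W" and id: "id \<in> hom W W"
    using hom_compose[OF f(1) g] hom_compose[OF g f(1)] by (simp_all add: hom_def)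
  have "g (f x) = x" "f (g x) = x" if "x \<in> carrier W" for x
    using hom_eqI[OF gf(1) id _ _ that] hom_eqI[OF gf(2) id _ _ that] assms by auto
  then have "bij_betw f (carrier W) (carrier W)"
    using f g by (intro bij_betw_byWitness[of _ g]) (auto simp: hom_def)
  then show ?thesis using f by (simp add: carrier_A Bij_def)
qed

section \<open>Inner automorphisms and the reduction to automorphisms fixing
  \<open>w\<close>\<close>

definition inner where "inner g = (\<lambda>x \<in> carrier W. conjg g x)"

lemma inner_hom: "g \<in> carrier W \<Longrightarrow> inner g \<in> hom W W"
  using conj_hom[of g] by (simp add: hom_def inner_def)

lemma inner_apply: "x \<in> carrier W \<Longrightarrow> inner g x = conjg g x"
  by (simp add: inner_def)

lemma inner_inv: "g \<in> carrier W \<Longrightarrow> x \<in> carrier W \<Longrightarrow> inner (inv\<^bsub>W\<^esub> g) (inner g x) = x"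
  using conj_mult[of "inv\<^bsub>W\<^esub> g" g x] by (simp add: inner_apply)

lemma inner_in_A: "g \<in> carrier W \<Longrightarrow> inner g \<in> carrier A"
proof (rule A_I[of "inner g" "inner (inv\<^bsub>W\<^esub> g)"])
  assume g: "g \<in> carrier W"
  show "inner g \<in> extensional (carrier W)" by (simp add: inner_def)
  show "inner (inv\<^bsub>W\<^esub> g) (inner g w) = w" "inner g (inner (inv\<^bsub>W\<^esub> g) w) = w"
    using g inner_inv[of g w] inner_inv[of "inv\<^bsub>W\<^esub> g" w] by simp_all
  fix i assume i: "i \<in> I"
  show "inner (inv\<^bsub>W\<^esub> g) (inner g (a i)) = a i" "inner g (inner (inv\<^bsub>W\<^esub> g) (a i)) = a i"
    using g a_closed[OF i] inner_inv[of g "a i"] inner_inv[of "inv\<^bsub>W\<^esub> g" "a i"] by simp_all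
qed (simp_all add: inner_hom)

lemma inner_auts_eq: "inner_auts W = inner ` carrier W"
  by (auto simp: inner_auts_def inner_def)

lemma a_neq_one: "i \<in> I \<Longrightarrow> a i \<noteq> \<one>\<^bsub>W\<^esub>"
  using a_pow_eq_one_iff[of i 1] t_ge3[of i] by auto

lemma A_conj: "\<phi> \<in> carrier A \<Longrightarrow> g \<in> carrier W \<Longrightarrow> x \<in> carrier W \<Longrightarrow> \<phi> (conjg g x) = conjg (\<phi> g) (\<phi> x)"
proof -
  assume a: "\<phi> \<in> carrier A" "g \<in> carrier W" "x \<in> carrier W"
  interpret \<phi>: group_hom W W \<phi> using a A_group_hom by blast
  show ?thesis using a by simp
qed

lemma conj_int_pow: "g \<in> carrier W \<Longrightarrow> x \<in> carrier W \<Longrightarrow> conjg g x [^]\<^bsub>W\<^esub> (k::int) = conjg g (x [^]\<^bsub>W\<^esub> k)"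
  using hom_int_pow[OF conj_hom _ group_W group_W] by simp

text \<open>Being inverted by \<open>w\<close> and being killed by the odd exponent
  \<open>t i\<close> both carry over from \<open>a i\<close> to its image, as \<open>\<psi>\<close>
  fixes \<open>w\<close>; injectivity makes the image nontrivial.\<close>

lemma aut_fixing_w:
  assumes \<psi>: "\<psi> \<in> carrier A" "\<psi> w = w" and i: "i \<in> I"
  obtains j k where "j \<in> I" "\<psi> (a i) = a j [^]\<^bsub>W\<^esub> (k::int)"
proof -
  interpret \<psi>: group_hom W W \<psi> using \<psi> A_group_hom by blast
  note ai = a_closed[OF i]
  have "\<psi> (a i) \<noteq> \<psi> \<one>\<^bsub>W\<^esub>"
    using A_inj[OF \<psi>(1)] a_neq_one[OF i] ai inj_onD by (metis W.one_closed)
  moreover have "w \<otimes>\<^bsub>W\<^esub> \<psi> (a i) \<otimes>\<^bsub>W\<^esub> w = \<psi> (w \<otimes>\<^bsub>W\<^esub> a i \<otimes>\<^bsub>W\<^esub> w)"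
    using ai \<psi> by simp
  then have "w \<otimes>\<^bsub>W\<^esub> \<psi> (a i) \<otimes>\<^bsub>W\<^esub> w = inv\<^bsub>W\<^esub> (\<psi> (a i))"
    using i ai by (simp only: w_a_w \<psi>.hom_inv)
  moreover have "\<psi> (a i) [^]\<^bsub>W\<^esub> t i = \<one>\<^bsub>W\<^esub>"
    using \<psi>.hom_nat_pow[OF ai, of "t i"] a_pow_t[OF i] by simp
  ultimately show ?thesis
    using inverted_odd_order[of "\<psi> (a i)" "t i"] that ai t_odd[OF i] by (metis \<psi>.hom_closed \<psi>.hom_one)
qed

text \<open>The image of \<open>w\<close> is again an involution, hence a conjugate of
  \<open>w\<close>; the conjugator gives the inner factor.\<close>

lemma aut_inner_decomp:
  assumes \<phi>: "\<phi> \<in> carrier A"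
  obtains g \<psi> where "g \<in> carrier W" "\<psi> \<in> carrier A" "\<psi> w = w" "\<phi> = inner g \<otimes>\<^bsub>A\<^esub> \<psi>"
proof -
  interpret \<phi>: group_hom W W \<phi> using \<phi> A_group_hom by blast
  have "w \<noteq> \<one>\<^bsub>W\<^esub>"
    using nf_evl[OF red_Nil] nf_evl_w[OF red_Nil] by auto
  then have "\<phi> w \<noteq> \<phi> \<one>\<^bsub>W\<^esub>"
    using A_inj[OF \<phi>] inj_onD by (metis W.one_closed w_closed)
  moreover have "\<phi> w \<otimes>\<^bsub>W\<^esub> \<phi> w = \<one>\<^bsub>W\<^esub>"
    using \<phi>.hom_mult[of w w] by simp
  ultimately obtain g where g: "g \<in> carrier W" "\<phi> w = conjg g w"
    using involution_conj_w[of "\<phi> w"] by auto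
  define \<psi> where "\<psi> = inv\<^bsub>A\<^esub> (inner g) \<otimes>\<^bsub>A\<^esub> \<phi>"
  have \<psi>: "\<psi> \<in> carrier A" "\<phi> = inner g \<otimes>\<^bsub>A\<^esub> \<psi>"
    using \<phi> inner_in_A[OF g(1)] by (simp_all add: \<psi>_def flip: A.m_assoc)
  have "\<psi> w = (inv\<^bsub>A\<^esub> (inner g)) (inner g w)"
    using g \<phi> inner_in_A[OF g(1)] by (simp add: \<psi>_def A_apply inner_apply)
  also have "\<dots> = w" using inner_in_A[OF g(1)] by (simp add: A_inv_apply)
  finally show ?thesis using that g \<psi> by blast
qed

text \<open>The conjugator \<open>g\<close> is allowed so that inner factors do not affect the
  relation.\<close>

definition moves :: "(nat list set \<Rightarrow> nat list set) \<Rightarrow> nat \<Rightarrow> nat \<Rightarrow> bool" where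
  "moves \<phi> i j \<longleftrightarrow> (\<exists>g\<in>carrier W. \<exists>k::int. \<phi> (a i) = conjg g (a j [^]\<^bsub>W\<^esub> k))"

lemma moves_ex:
  assumes \<phi>: "\<phi> \<in> carrier A" and i: "i \<in> I"
  obtains j where "j \<in> I" "moves \<phi> i j"
proof -
  obtain g \<psi> where g: "g \<in> carrier W" "\<psi> \<in> carrier A" "\<psi> w = w" "\<phi> = inner g \<otimes>\<^bsub>A\<^esub> \<psi>"
    using aut_inner_decomp[OF \<phi>] .
  obtain j k where "j \<in> I" "\<psi> (a i) = a j [^]\<^bsub>W\<^esub> (k::int)"
    using aut_fixing_w[OF g(2,3) i] .
  then show ?thesis
    using that[of j] g i by (auto simp: moves_def A_apply inner_in_A inner_apply)
qed

text \<open>Sending every generator except \<open>j\<close> to generator 1 kills all rotations but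
  \<open>a j\<close>. This retracts the group onto the dihedral subgroup of \<open>w\<close> and
  \<open>a j\<close>, and separates conjugates of powers of different rotations.\<close>

lemma retraction:
  assumes j: "j \<in> I"
  obtains p where "p \<in> hom W W" "p (a j) = a j" "\<And>i. i \<in> I \<Longrightarrow> i \<noteq> j \<Longrightarrow> p (a i) = \<one>\<^bsub>W\<^esub>"
proof -
  define f where "f = (\<lambda>m. if m = j then [j] else [1::nat])"
  have f: "\<And>m. m \<in> {1..n} \<Longrightarrow> f m \<in> L"
    "\<And>m. m \<in> {1..n} \<Longrightarrow> cl (f m) \<otimes>\<^bsub>W\<^esub> cl (f m) = \<one>\<^bsub>W\<^esub>"
    using j by (auto simp: f_def gen_involution simp del: One_nat_def)
  have fa: "cl (f 1) \<otimes>\<^bsub>W\<^esub> cl (f i) = (if i = j then a j else \<one>\<^bsub>W\<^esub>)" if "i \<in> I" for i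
    using j that by (simp add: f_def gen_eq flip: w_def)
  then have star: "\<And>i. i \<in> I \<Longrightarrow> (cl (f 1) \<otimes>\<^bsub>W\<^esub> cl (f i)) [^]\<^bsub>W\<^esub> t i = \<one>\<^bsub>W\<^esub>"
    using a_pow_t by simp
  show ?thesis
    using that[of "subst_map n t f"] subst_map_hom[OF f star] subst_map_a[OF f star] fa j by simp
qed

text \<open>Under the retraction for \<open>j\<close>, a conjugate of a power of \<open>a j'\<close>
  becomes trivial. The power of \<open>a j\<close> conjugate to it is then trivial too, and
  \<open>\<phi>\<close> would kill \<open>a i\<close>.\<close>

lemma moves_unique:
  assumes \<phi>: "\<phi> \<in> carrier A" and i: "i \<in> I" and j: "j \<in> I" "moves \<phi> i j" and j': "j' \<in> I" "moves \<phi> i j'"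
  shows "j = j'"
proof (rule ccontr)
  assume neq: "j \<noteq> j'"
  obtain g k where g: "g \<in> carrier W" "\<phi> (a i) = conjg g (a j [^]\<^bsub>W\<^esub> (k::int))"
    using j unfolding moves_def by auto
  obtain h l where h: "h \<in> carrier W" "\<phi> (a i) = conjg h (a j' [^]\<^bsub>W\<^esub> (l::int))"
    using j' unfolding moves_def by auto
  obtain p where p: "p \<in> hom W W" "p (a j) = a j" "p (a j') = \<one>\<^bsub>W\<^esub>"
    using retraction[OF j(1)] j' neq by metis
  interpret p: group_hom W W p
    using p(1) by (simp add: group_hom.intro group_hom_axioms.intro group_W)
  note aj = a_closed[OF j(1)] and aj' = a_closed[OF j'(1)]
  have "conjg (p g) (a j [^]\<^bsub>W\<^esub> k) = p (\<phi> (a i))"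
    unfolding g(2) using g(1) aj p by (simp add: p.hom_int_pow)
  also have "\<dots> = \<one>\<^bsub>W\<^esub>"
    unfolding h(2) using h(1) aj' p by (simp add: p.hom_int_pow)
  finally have "conjg (p g) (a j [^]\<^bsub>W\<^esub> k) = \<one>\<^bsub>W\<^esub>" .
  then have "conjg (inv\<^bsub>W\<^esub> (p g)) (conjg (p g) (a j [^]\<^bsub>W\<^esub> k)) = \<one>\<^bsub>W\<^esub>"
    using g(1) by simp
  then have "a j [^]\<^bsub>W\<^esub> k = \<one>\<^bsub>W\<^esub>"
    using g(1) aj conj_mult[of "inv\<^bsub>W\<^esub> (p g)" "p g" "a j [^]\<^bsub>W\<^esub> k"] by simp
  then have "\<phi> (a i) = \<phi> \<one>\<^bsub>W\<^esub>"
    using g hom_one[OF A_hom[OF \<phi>] group_W group_W] by simp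
  then show False
    using A_inj[OF \<phi>] a_neq_one[OF i] a_closed[OF i] inj_onD by (metis W.one_closed)
qed

lemma moves_comp:
  assumes \<phi>: "\<phi> \<in> carrier A" and \<psi>: "\<psi> \<in> carrier A" and ij: "i \<in> I" "j \<in> I" "m \<in> I"
    and "moves \<psi> i j" "moves \<phi> j m"
  shows "moves (\<phi> \<otimes>\<^bsub>A\<^esub> \<psi>) i m"
proof -
  obtain g k where g: "g \<in> carrier W" "\<psi> (a i) = conjg g (a j [^]\<^bsub>W\<^esub> (k::int))"
    using assms unfolding moves_def by auto
  obtain h l where h: "h \<in> carrier W" "\<phi> (a j) = conjg h (a m [^]\<^bsub>W\<^esub> (l::int))"
    using assms unfolding moves_def by auto
  interpret \<phi>: group_hom W W \<phi> using \<phi> A_group_hom by blast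
  note c = a_closed[OF ij(1)] a_closed[OF ij(2)] a_closed[OF ij(3)]
  have "(\<phi> \<otimes>\<^bsub>A\<^esub> \<psi>) (a i) = conjg (\<phi> g) (\<phi> (a j) [^]\<^bsub>W\<^esub> k)"
    using \<phi> \<psi> c g by (simp add: A_apply A_conj \<phi>.hom_int_pow)
  also have "\<dots> = conjg (\<phi> g \<otimes>\<^bsub>W\<^esub> h) (a m [^]\<^bsub>W\<^esub> (l * k))"
    using c g h by (simp add: conj_int_pow W.int_pow_pow conj_mult)
  finally show ?thesis
    using g h unfolding moves_def by (intro bexI[of _ "\<phi> g \<otimes>\<^bsub>W\<^esub> h"] exI[of _ "l * k"]) auto
qed

text \<open>Restricted to \<open>I\<close> because elements of \<open>BijGroup I\<close> are
  extensional.\<close>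

definition index_perm :: "(nat list set \<Rightarrow> nat list set) \<Rightarrow> nat \<Rightarrow> nat" where
  "index_perm \<phi> = (\<lambda>i \<in> I. THE j. j \<in> I \<and> moves \<phi> i j)"

lemma index_perm_eq: "\<phi> \<in> carrier A \<Longrightarrow> i \<in> I \<Longrightarrow> j \<in> I \<Longrightarrow> moves \<phi> i j \<Longrightarrow> index_perm \<phi> i = j"
  unfolding index_perm_def using moves_unique by (auto intro!: the_equality)

lemma index_perm_moves: "\<phi> \<in> carrier A \<Longrightarrow> i \<in> I \<Longrightarrow> index_perm \<phi> i \<in> I \<and> moves \<phi> i (index_perm \<phi> i)"
  by (metis moves_ex index_perm_eq)

lemma index_perm_mult:
  assumes "\<phi> \<in> carrier A" "\<psi> \<in> carrier A"
  shows "index_perm (\<phi> \<otimes>\<^bsub>A\<^esub> \<psi>) = compose I (index_perm \<phi>) (index_perm \<psi>)"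
proof (rule extensionalityI[of _ I])
  fix i assume "i \<in> I"
  then show "index_perm (\<phi> \<otimes>\<^bsub>A\<^esub> \<psi>) i = compose I (index_perm \<phi>) (index_perm \<psi>) i"
    using index_perm_moves[OF assms(2), of i] index_perm_moves[OF assms(1), of "index_perm \<psi> i"]
      moves_comp[OF assms, of i "index_perm \<psi> i" "index_perm \<phi> (index_perm \<psi> i)"]
      index_perm_eq[OF A.m_closed[OF assms], of i "index_perm \<phi> (index_perm \<psi> i)"]
    by (simp only: compose_eq)
qed (auto simp: index_perm_def compose_def)

lemma moves_self: "i \<in> I \<Longrightarrow> \<phi> (a i) = a i [^]\<^bsub>W\<^esub> (k::int) \<Longrightarrow> moves \<phi> i i"
  unfolding moves_def by (intro bexI[of _ "\<one>\<^bsub>W\<^esub>"] exI[of _ k]) (auto simp del: atLeastAtMost_iff)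

lemma index_perm_one: "index_perm \<one>\<^bsub>A\<^esub> = (\<lambda>i\<in>I. i)"
proof (rule extensionalityI[of _ I])
  fix i assume i: "i \<in> I"
  have "moves \<one>\<^bsub>A\<^esub> i i" by (rule moves_self[OF i, of _ 1]) (use i in \<open>simp add: A_one\<close>)
  then show "index_perm \<one>\<^bsub>A\<^esub> i = (\<lambda>i\<in>I. i) i" using i by (simp add: index_perm_eq)
qed (auto simp: index_perm_def)

lemma index_perm_inv:
  assumes \<phi>: "\<phi> \<in> carrier A" and i: "i \<in> I"
  shows "index_perm (inv\<^bsub>A\<^esub> \<phi>) (index_perm \<phi> i) = i"
proof -
  have "index_perm (inv\<^bsub>A\<^esub> \<phi>) (index_perm \<phi> i) = index_perm (inv\<^bsub>A\<^esub> \<phi> \<otimes>\<^bsub>A\<^esub> \<phi>) i"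
    using index_perm_mult[of "inv\<^bsub>A\<^esub> \<phi>" \<phi>] \<phi> by (simp only: A.inv_closed compose_eq[OF i])
  also have "\<dots> = i" using \<phi> i by (simp only: A.l_inv index_perm_one restrict_apply')
  finally show ?thesis .
qed

lemma index_perm_Bij: "\<phi> \<in> carrier A \<Longrightarrow> index_perm \<phi> \<in> Bij I"
proof -
  assume \<phi>: "\<phi> \<in> carrier A"
  have "bij_betw (index_perm \<phi>) I I"
    using \<phi> index_perm_inv[of \<phi>] index_perm_inv[of "inv\<^bsub>A\<^esub> \<phi>"] index_perm_moves
    by (intro bij_betw_byWitness[of _ "index_perm (inv\<^bsub>A\<^esub> \<phi>)"]) (auto simp del: atLeastAtMost_iff)
  then show ?thesis by (simp add: Bij_def index_perm_def)
qed

lemma index_perm_hom: "group_hom A (BijGroup I) index_perm"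
proof (intro group_hom.intro group_hom_axioms.intro group_BijGroup A.is_group)
  show "index_perm \<in> hom A (BijGroup I)"
    by (rule homI) (simp_all add: BijGroup_def index_perm_Bij index_perm_mult)
qed

text \<open>The image of \<open>a i\<close> is conjugate to a power of \<open>a j\<close> with
  \<open>j = index_perm \<phi> i\<close>, so its \<open>t j\<close>-th power is trivial; injectivity
  brings this back to \<open>a i\<close>. The inverse automorphism gives the opposite
  divisibility.\<close>

lemma t_index_perm_dvd: "\<phi> \<in> carrier A \<Longrightarrow> i \<in> I \<Longrightarrow> t i dvd t (index_perm \<phi> i)"
proof -
  assume \<phi>: "\<phi> \<in> carrier A" and i: "i \<in> I"
  define j where "j = index_perm \<phi> i"
  have j: "j \<in> I" "moves \<phi> i j" using index_perm_moves[OF \<phi> i] by (auto simp: j_def)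
  interpret \<phi>: group_hom W W \<phi> using \<phi> A_group_hom by blast
  obtain g k where g: "g \<in> carrier W" "\<phi> (a i) = conjg g (a j [^]\<^bsub>W\<^esub> (k::int))"
    using j unfolding moves_def by auto
  note aj = a_closed[OF j(1)] and ai = a_closed[OF i]
  have "a j [^]\<^bsub>W\<^esub> (k * int (t j)) = \<one>\<^bsub>W\<^esub>" using a_pow_zero[OF j(1)] by simp
  then have "\<phi> (a i [^]\<^bsub>W\<^esub> int (t j)) = \<phi> \<one>\<^bsub>W\<^esub>"
    using g ai aj by (simp add: \<phi>.hom_int_pow conj_int_pow W.int_pow_pow)
  then have "a i [^]\<^bsub>W\<^esub> int (t j) = \<one>\<^bsub>W\<^esub>"
    using inj_onD[OF A_inj[OF \<phi>]] ai by simp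
  then show ?thesis using a_pow_eq_one_iff[OF i] by (simp add: j_def)
qed

lemma t_index_perm: "\<phi> \<in> carrier A \<Longrightarrow> i \<in> I \<Longrightarrow> t (index_perm \<phi> i) = t i"
  using t_index_perm_dvd[of \<phi> i] t_index_perm_dvd[of "inv\<^bsub>A\<^esub> \<phi>" "index_perm \<phi> i"] index_perm_inv[of \<phi> i] index_perm_moves[of \<phi> i]
  by (simp add: dvd_antisym)

subsection \<open>Inner automorphisms, the group C and graph automorphisms\<close>

lemma theta_hom_apply:
  fixes k :: nat
  assumes i: "i \<in> I"
  shows theta_hom: "theta n t i k \<in> hom W W"
    and theta_w: "theta n t i k w = w"
    and theta_a: "\<And>j. j \<in> I \<Longrightarrow> theta n t i k (a j) = (if j = i then a i [^]\<^bsub>W\<^esub> int k else a j)"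
proof -
  define f where "f = (\<lambda>j. if j = i then 1 # concat (replicate k [1, i]) else [j])"
  note ai = a_closed[OF i]
  have L: "concat (replicate k [1, i]) \<in> L" using i n_pos by (intro concat_replicate_lists) auto
  have fL: "\<And>j. j \<in> {1..n} \<Longrightarrow> f j \<in> L" using L n_pos by (auto simp: f_def)
  have "cl (1 # concat (replicate k [1, i])) = w \<otimes>\<^bsub>W\<^esub> cl (concat (replicate k [1, i]))"
    using cl_Cons[OF _ L, of 1] n_pos by (simp add: w_def)
  also have "cl (concat (replicate k [1, i])) = a i [^]\<^bsub>W\<^esub> int k"
    using cl_replicate[of "[1, i]" k] i by (simp add: a_def int_pow_int)
  finally have fi: "cl (f i) = w \<otimes>\<^bsub>W\<^esub> a i [^]\<^bsub>W\<^esub> int k" by (simp add: f_def)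
  have f1: "f 1 = [1]" using i by (simp add: f_def)
  have inv: "cl (f j) \<otimes>\<^bsub>W\<^esub> cl (f j) = \<one>\<^bsub>W\<^esub>" if "j \<in> {1..n}" for j
  proof (cases "j = i")
    case True
    have p: "a i [^]\<^bsub>W\<^esub> int k \<in> carrier W" using ai by simp
    \<comment> \<open>Grouped this way, the square is a power of \<open>a i\<close> inverted by
      \<open>w\<close>, times the same power.\<close>
    have "cl (f j) \<otimes>\<^bsub>W\<^esub> cl (f j) = (w \<otimes>\<^bsub>W\<^esub> a i [^]\<^bsub>W\<^esub> int k \<otimes>\<^bsub>W\<^esub> w) \<otimes>\<^bsub>W\<^esub> a i [^]\<^bsub>W\<^esub> int k"
      using p by (simp add: True fi W.m_assoc)
    also have "\<dots> = \<one>\<^bsub>W\<^esub>" using p ai by (simp only: w_a_pow[OF i] W.int_pow_neg W.l_inv)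
    finally show ?thesis .
  next
    case False
    then show ?thesis using gen_involution[OF that] by (simp add: f_def)
  qed
  have fa: "cl (f 1) \<otimes>\<^bsub>W\<^esub> cl (f j) = (if j = i then a i [^]\<^bsub>W\<^esub> int k else a j)" if "j \<in> I" for j
    using ai gen_eq[OF that] a_closed[OF that] by (auto simp: f1 fi simp flip: w_def) (simp_all add: f_def)
  have star: "(cl (f 1) \<otimes>\<^bsub>W\<^esub> cl (f j)) [^]\<^bsub>W\<^esub> t j = \<one>\<^bsub>W\<^esub>" if "j \<in> I" for j
  proof (cases "j = i")
    case True
    then have "(cl (f 1) \<otimes>\<^bsub>W\<^esub> cl (f j)) [^]\<^bsub>W\<^esub> t j = (a i [^]\<^bsub>W\<^esub> int k) [^]\<^bsub>W\<^esub> int (t i)"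
      using fa[OF that] by (simp add: int_pow_int)
    also have "\<dots> = \<one>\<^bsub>W\<^esub>"
      using ai a_pow_eq_one_iff[OF i, of "int k * int (t i)"] by (simp add: W.int_pow_pow)
    finally show ?thesis .
  next
    case False
    then show ?thesis using fa[OF that] a_pow_t[OF that] by simp
  qed
  have th: "theta n t i k = subst_map n t f" by (simp add: theta_def f_def)
  show "theta n t i k \<in> hom W W"
    unfolding th by (rule subst_map_hom[OF fL inv star])
  show "theta n t i k w = w"
    unfolding th using subst_map_w[OF fL inv star] by (simp add: f1 flip: w_def)
  show "theta n t i k (a j) = (if j = i then a i [^]\<^bsub>W\<^esub> int k else a j)" if "j \<in> I" for j
    unfolding th using subst_map_a[OF fL inv star that] fa[OF that] by simp
qed

lemma theta_in_A:
  assumes i: "i \<in> I" and k: "coprime k (t i)"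
  shows "theta n t i k \<in> carrier A"
proof -
  have "k \<noteq> 0" using k t_ge3[OF i] by (cases k) auto
  \<comment> \<open>\<open>l\<close> is an inverse of \<open>k\<close> modulo \<open>t i\<close>, so
    \<open>theta n t i l\<close> will invert \<open>theta n t i k\<close>.\<close>
  then obtain l m where "k * l = t i * m + gcd k (t i)" using bezout_nat by blast
  then have "int k * int l = int (t i) * int m + 1"
    using k by (metis coprime_imp_gcd_eq_1 of_nat_1 of_nat_add of_nat_mult)
  then have a1: "a i [^]\<^bsub>W\<^esub> (int k * int l) = a i"
    using a_pow_eq_one_iff[OF i, of "int (t i) * int m"] a_closed[OF i]
    by (simp add: W.int_pow_mult)
  have c: "theta n t i p (theta n t i q w) = w" for p q
    using theta_w[OF i] by simp
  have d: "theta n t i p (theta n t i q (a j)) = (if j = i then a i [^]\<^bsub>W\<^esub> (int p * int q) else a j)"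
    if j: "j \<in> I" for p q j
    using hom_int_pow[OF theta_hom[OF i] a_closed[OF i] group_W group_W, of p "int q"]
      theta_a[OF i j] theta_a[OF i i] a_closed[OF i] by (simp add: W.int_pow_pow)
  show ?thesis
  proof (rule A_I[of "theta n t i k" "theta n t i l"])
    show "theta n t i k \<in> extensional (carrier W)" by (simp add: theta_def subst_map_def)
    fix j assume j: "j \<in> I"
    show "theta n t i l (theta n t i k (a j)) = a j" "theta n t i k (theta n t i l (a j)) = a j"
      using d[OF j] a1 by (simp_all add: mult.commute)
  qed (use c theta_hom[OF i] in simp_all)
qed

abbreviation "thetas \<equiv> {theta n t i k | i k. i \<in> I \<and> 1 \<le> k \<and> k < t i \<and> coprime k (t i)}"

text \<open>If \<open>d\<close> divides both the exponent and \<open>t i\<close>, then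
  \<open>\<psi>\<close> kills the power of \<open>a i\<close> with exponent
  \<open>t i div d\<close>; injectivity leaves only \<open>d = 1\<close>.\<close>

lemma coprime_exponent:
  assumes \<psi>: "\<psi> \<in> carrier A" and i: "i \<in> I" and e: "\<psi> (a i) = a i [^]\<^bsub>W\<^esub> (e::int)"
  obtains k where "\<psi> (a i) = a i [^]\<^bsub>W\<^esub> int k" "1 \<le> k" "k < t i" "coprime k (t i)"
proof -
  interpret \<psi>: group_hom W W \<psi> using \<psi> A_group_hom by blast
  note ai = a_closed[OF i]
  define k where "k = nat (e mod int (t i))"
  have k: "int k = e mod int (t i)" "k < t i"
    using t_pos[OF i] by (simp_all add: k_def nat_less_iff)
  have \<psi>k: "\<psi> (a i) = a i [^]\<^bsub>W\<^esub> int k" using e a_pow_mod[OF i, of e] k by simp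
  define d where "d = gcd k (t i)"
  have d: "d * (k div d) = k" "d * (t i div d) = t i" by (simp_all add: d_def)
  have "k * (t i div d) = t i * (k div d)"
    using d by (metis mult.assoc mult.commute)
  then have "int k * int (t i div d) = int (t i) * int (k div d)" by (metis of_nat_mult)
  then have "a i [^]\<^bsub>W\<^esub> (int k * int (t i div d)) = \<one>\<^bsub>W\<^esub>"
    using a_pow_eq_one_iff[OF i] by simp
  then have "\<psi> (a i [^]\<^bsub>W\<^esub> int (t i div d)) = \<psi> \<one>\<^bsub>W\<^esub>"
    using ai by (simp add: \<psi>.hom_int_pow \<psi>k W.int_pow_pow)
  then have "a i [^]\<^bsub>W\<^esub> int (t i div d) = \<one>\<^bsub>W\<^esub>"
    using inj_onD[OF A_inj[OF \<psi>]] ai by simp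
  then have "t i dvd t i div d" using a_pow_eq_one_iff[OF i] by simp
  moreover have "t i > 0" using t_ge3[OF i] by simp
  moreover from this have "t i div d > 0" using d(2) by (cases "t i div d") auto
  ultimately have "d = 1"
    using dvd_imp_le[of "t i" "t i div d"] div_less_dividend[of d "t i"] d(2) by (cases "d = 0") force+
  then have "coprime k (t i)" by (simp add: d_def coprime_iff_gcd_eq_1)
  moreover from this have "k \<noteq> 0" using t_ge3[OF i] by (cases k) auto
  ultimately show ?thesis using that[OF \<psi>k] k(2) by simp
qed

text \<open>Induction on a finite set \<open>J\<close> outside of which every \<open>a i\<close> is
  fixed: one power automorphism is split off for each element of \<open>J\<close>.\<close>

lemma fixing_w_in_Csub:
  assumes "\<psi> \<in> carrier A" "\<psi> w = w" "\<forall>i\<in>I. \<exists>k::int. \<psi> (a i) = a i [^]\<^bsub>W\<^esub> k"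
  shows "\<psi> \<in> Csub n t"
proof -
  have "finite J \<Longrightarrow> \<chi> \<in> carrier A \<Longrightarrow> \<chi> w = w \<Longrightarrow> \<forall>i\<in>I. \<exists>k::int. \<chi> (a i) = a i [^]\<^bsub>W\<^esub> k
      \<Longrightarrow> \<forall>i\<in>I - J. \<chi> (a i) = a i \<Longrightarrow> \<chi> \<in> Csub n t" for J \<chi>
  proof (induction J arbitrary: \<chi> rule: finite_induct)
    case empty
    have "\<chi> = \<one>\<^bsub>A\<^esub>"
      using empty by (intro A_eqI) (simp_all add: A_one del: atLeastAtMost_iff)
    then show ?case by (simp add: Csub_def generate.one)
  next
    case (insert j J)
    show ?case
    proof (cases "j \<in> I")
      case False
      then show ?thesis using insert by blast
    next
      case j: True
      then obtain e where "\<chi> (a j) = a j [^]\<^bsub>W\<^esub> (e::int)" using insert.prems by blast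
      then obtain k where k: "\<chi> (a j) = a j [^]\<^bsub>W\<^esub> int k" "1 \<le> k" "k < t j" "coprime k (t j)"
        using coprime_exponent[OF insert.prems(1) j] by blast
      define \<theta> where "\<theta> = theta n t j k"
      have \<theta>: "\<theta> \<in> carrier A" using theta_in_A[OF j k(4)] by (simp add: \<theta>_def)
      \<comment> \<open>The quotient fixes \<open>a j\<close> as well and agrees with
        \<open>\<chi>\<close> on the other rotations, since \<open>\<theta>\<close> fixes all their
        powers.\<close>
      define \<rho> where "\<rho> = inv\<^bsub>A\<^esub> \<theta> \<otimes>\<^bsub>A\<^esub> \<chi>"
      have \<rho>: "\<rho> \<in> carrier A" "\<chi> = \<theta> \<otimes>\<^bsub>A\<^esub> \<rho>"
        using \<theta> insert.prems(1) by (simp_all add: \<rho>_def flip: A.m_assoc)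
      have \<rho>_apply: "\<rho> x = y" if "x \<in> carrier W" "y \<in> carrier W" "\<chi> x = \<theta> y" for x y
        using \<theta> insert.prems(1) that A_inv_apply[OF \<theta>, of y] by (simp add: \<rho>_def A_apply)
      have "\<rho> w = w"
        using insert.prems(2) theta_w[OF j, of k] by (intro \<rho>_apply) (simp_all add: \<theta>_def)
      moreover have \<rho>j: "\<rho> (a j) = a j"
        using k(1) theta_a[OF j j, of k] a_closed[OF j] by (intro \<rho>_apply) (simp_all add: \<theta>_def)
      moreover have \<rho>i: "\<rho> (a i) = \<chi> (a i)" if i: "i \<in> I" "i \<noteq> j" for i
      proof -
        obtain m where m: "\<chi> (a i) = a i [^]\<^bsub>W\<^esub> (m::int)" using insert.prems(3) i by blast
        have "\<theta> (\<chi> (a i)) = \<chi> (a i)"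
          using hom_int_pow[OF A_hom[OF \<theta>] a_closed[OF i(1)] group_W group_W, of m]
            theta_a[OF j i(1), of k] i(2) by (simp add: m \<theta>_def)
        then show ?thesis using m a_closed[OF i(1)] by (intro \<rho>_apply) simp_all
      qed
      moreover have "\<exists>k::int. \<rho> (a i) = a i [^]\<^bsub>W\<^esub> k" if i: "i \<in> I" for i
      proof (cases "i = j")
        case True
        then show ?thesis using \<rho>j a_closed[OF i] by (intro exI[of _ 1]) simp
      next
        case False
        then show ?thesis using \<rho>i[OF i] insert.prems(3) i by simp
      qed
      moreover have "\<rho> (a i) = a i" if i: "i \<in> I - J" for i
        using i \<rho>i[of i] \<rho>j insert.prems(4) by (cases "i = j") blast+
      ultimately have "\<rho> \<in> Csub n t" using insert.IH[OF \<rho>(1)] by blast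
      moreover have "\<theta> \<in> Csub n t"
        unfolding Csub_def \<theta>_def using j k by (intro generate.incl) blast
      ultimately show ?thesis unfolding Csub_def by (subst \<rho>(2)) (rule generate.eng)
    qed
  qed
  from this[of I \<psi>] show ?thesis using assms by blast
qed

section \<open>The kernel of the index permutation\<close>

abbreviation "ker \<equiv> kernel A (BijGroup I) index_perm"

lemma ker_iff: "\<phi> \<in> ker \<longleftrightarrow> \<phi> \<in> carrier A \<and> (\<forall>i\<in>I. index_perm \<phi> i = i)"
proof -
  have "index_perm \<phi> = (\<lambda>i\<in>I. i) \<longleftrightarrow> (\<forall>i\<in>I. index_perm \<phi> i = i)"
    by (auto simp: index_perm_def restrict_def fun_eq_iff)
  then show ?thesis by (simp add: kernel_def BijGroup_def)
qed

lemma kerI: "\<phi> \<in> carrier A \<Longrightarrow> (\<And>i. i \<in> I \<Longrightarrow> moves \<phi> i i) \<Longrightarrow> \<phi> \<in> ker"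
  using index_perm_eq ker_iff by blast

text \<open>Recognising the product set as a kernel gives the subgroup property and normality at
  once.\<close>

lemma ker_eq: "inner_auts W <#>\<^bsub>A\<^esub> Csub n t = ker"
proof
  have sub: "subgroup ker A" by (rule group_hom.subgroup_kernel[OF index_perm_hom])
  have "inner g \<in> ker" if g: "g \<in> carrier W" for g
  proof (rule kerI[OF inner_in_A[OF g]])
    fix i assume i: "i \<in> I"
    have "inner g (a i) = conjg g (a i [^]\<^bsub>W\<^esub> (1::int))"
      using g a_closed[OF i] by (simp add: inner_apply)
    then show "moves (inner g) i i" using g unfolding moves_def by blast
  qed
  moreover have "thetas \<subseteq> ker"
  proof
    fix \<theta> assume "\<theta> \<in> thetas"
    then obtain i k where ik: "\<theta> = theta n t i k" "i \<in> I" "coprime k (t i)" by auto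
    show "\<theta> \<in> ker" unfolding ik(1)
    proof (rule kerI[OF theta_in_A[OF ik(2,3)]])
      fix j assume j: "j \<in> I"
      then show "moves (theta n t i k) j j"
        using theta_a[OF ik(2) j, of k] a_closed[OF j]
        by (intro moves_self[OF j, of _ "if j = i then int k else 1"]) simp
    qed
  qed
  then have "Csub n t \<subseteq> ker"
    unfolding Csub_def using A.generate_subgroup_incl sub by blast
  ultimately show "inner_auts W <#>\<^bsub>A\<^esub> Csub n t \<subseteq> ker"
    unfolding set_mult_def inner_auts_eq using subgroup.m_closed[OF sub] by blast
next
  show "ker \<subseteq> inner_auts W <#>\<^bsub>A\<^esub> Csub n t"
  proof
    fix \<phi> assume "\<phi> \<in> ker"
    then have \<phi>: "\<phi> \<in> carrier A" "\<And>i. i \<in> I \<Longrightarrow> index_perm \<phi> i = i" using ker_iff by blast+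
    obtain g \<psi> where g: "g \<in> carrier W" "\<psi> \<in> carrier A" "\<psi> w = w" "\<phi> = inner g \<otimes>\<^bsub>A\<^esub> \<psi>"
      using aut_inner_decomp[OF \<phi>(1)] .
    have "\<exists>k::int. \<psi> (a i) = a i [^]\<^bsub>W\<^esub> k" if i: "i \<in> I" for i
    proof -
      obtain j k where j: "j \<in> I" "\<psi> (a i) = a j [^]\<^bsub>W\<^esub> (k::int)"
        using aut_fixing_w[OF g(2,3) i] .
      \<comment> \<open>The inner factor \<open>g\<close> is just the conjugator that
        \<open>moves\<close> allows, so membership in the kernel forces
        \<open>j = i\<close>.\<close>
      have "moves \<phi> i j"
        unfolding moves_def using g j i
        by (intro bexI[of _ g] exI[of _ k]) (simp_all add: A_apply inner_in_A inner_apply)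
      then have "j = i" using index_perm_eq[OF \<phi>(1) i j(1)] \<phi>(2)[OF i] by simp
      then show ?thesis using j by blast
    qed
    then have "\<psi> \<in> Csub n t" using fixing_w_in_Csub[OF g(2,3)] by blast
    then show "\<phi> \<in> inner_auts W <#>\<^bsub>A\<^esub> Csub n t"
      using g unfolding set_mult_def inner_auts_eq by blast
  qed
qed

text \<open>Preservation of labels is what \<open>t_index_perm\<close> delivers;
  \<open>blocks_preserved_iff\<close> later translates it into preservation of blocks.\<close>

definition label_perms :: "(nat \<Rightarrow> nat) set" where
  "label_perms = {\<alpha>. bij_betw \<alpha> I I \<and> (\<forall>i\<in>I. t (\<alpha> i) = t i)}"

lemma label_perms_in: "\<alpha> \<in> label_perms \<Longrightarrow> i \<in> I \<Longrightarrow> \<alpha> i \<in> I"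
  unfolding label_perms_def by (blast dest: bij_betwE)

lemma graph_aut_hom_apply:
  assumes \<alpha>: "\<alpha> \<in> label_perms"
  shows graph_aut_hom: "graph_aut n t \<alpha> \<in> hom W W"
    and graph_aut_w: "graph_aut n t \<alpha> w = w"
    and graph_aut_a: "\<And>i. i \<in> I \<Longrightarrow> graph_aut n t \<alpha> (a i) = a (\<alpha> i)"
proof -
  define f where "f = (\<lambda>j. if j = 1 then [1] else [\<alpha> j])"
  have \<alpha>I: "j \<in> {1..n} \<Longrightarrow> j \<noteq> 1 \<Longrightarrow> \<alpha> j \<in> {1..n}" for j
    using label_perms_in[OF \<alpha>, of j] by auto
  have fL: "\<And>j. j \<in> {1..n} \<Longrightarrow> f j \<in> L" using \<alpha>I n_pos by (simp add: f_def)
  have inv: "cl (f j) \<otimes>\<^bsub>W\<^esub> cl (f j) = \<one>\<^bsub>W\<^esub>" if "j \<in> {1..n}" for j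
    using gen_involution[OF that] gen_involution[OF \<alpha>I[OF that]] by (cases "j = 1") (simp_all add: f_def)
  have fa: "cl (f 1) \<otimes>\<^bsub>W\<^esub> cl (f i) = a (\<alpha> i)" if i: "i \<in> I" for i
    using gen_eq[OF label_perms_in[OF \<alpha> i]] a_closed[OF label_perms_in[OF \<alpha> i]] i
    by (simp add: f_def flip: w_def)
  have star: "(cl (f 1) \<otimes>\<^bsub>W\<^esub> cl (f i)) [^]\<^bsub>W\<^esub> t i = \<one>\<^bsub>W\<^esub>" if i: "i \<in> I" for i
  proof -
    have "t (\<alpha> i) = t i" using \<alpha> i by (simp add: label_perms_def)
    then show ?thesis using fa[OF i] a_pow_t[OF label_perms_in[OF \<alpha> i]] by simp
  qed
  have gr: "graph_aut n t \<alpha> = subst_map n t f" by (simp add: graph_aut_def f_def)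
  show "graph_aut n t \<alpha> \<in> hom W W"
    unfolding gr by (rule subst_map_hom[OF fL inv star])
  show "graph_aut n t \<alpha> w = w"
    unfolding gr using subst_map_w[OF fL inv star] by (simp add: f_def flip: w_def)
  show "graph_aut n t \<alpha> (a i) = a (\<alpha> i)" if "i \<in> I" for i
    unfolding gr using subst_map_a[OF fL inv star that] fa[OF that] by simp
qed

lemma label_perms_inv:
  assumes \<alpha>: "\<alpha> \<in> label_perms"
  shows "inv_into I \<alpha> \<in> label_perms"
proof -
  have b: "bij_betw \<alpha> I I" using \<alpha> by (simp add: label_perms_def)
  have "t (inv_into I \<alpha> i) = t i" if i: "i \<in> I" for i
    using \<alpha> bij_betw_inv_into_right[OF b i] bij_betwE[OF bij_betw_inv_into[OF b]] i
    unfolding label_perms_def by fastforce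
  then show ?thesis using bij_betw_inv_into[OF b] by (simp add: label_perms_def)
qed

lemma graph_aut_in_A:
  assumes \<alpha>: "\<alpha> \<in> label_perms"
  shows "graph_aut n t \<alpha> \<in> carrier A"
proof (rule A_I[of "graph_aut n t \<alpha>" "graph_aut n t (inv_into I \<alpha>)"])
  let ?\<beta> = "inv_into I \<alpha>"
  have b: "bij_betw \<alpha> I I" using \<alpha> by (simp add: label_perms_def)
  note \<beta> = label_perms_inv[OF \<alpha>]
  show "graph_aut n t \<alpha> \<in> hom W W" "graph_aut n t ?\<beta> \<in> hom W W"
    using \<alpha> \<beta> by (simp_all add: graph_aut_hom)
  show "graph_aut n t \<alpha> \<in> extensional (carrier W)" by (simp add: graph_aut_def subst_map_def)
  show "graph_aut n t ?\<beta> (graph_aut n t \<alpha> w) = w" "graph_aut n t \<alpha> (graph_aut n t ?\<beta> w) = w"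
    using \<alpha> \<beta> by (simp_all add: graph_aut_w)
  fix i assume i: "i \<in> I"
  show "graph_aut n t ?\<beta> (graph_aut n t \<alpha> (a i)) = a i"
    using graph_aut_a[OF \<alpha> i] graph_aut_a[OF \<beta> label_perms_in[OF \<alpha> i]] bij_betw_inv_into_left[OF b i]
    by simp
  show "graph_aut n t \<alpha> (graph_aut n t ?\<beta> (a i)) = a i"
    using graph_aut_a[OF \<beta> i] graph_aut_a[OF \<alpha> label_perms_in[OF \<beta> i]] bij_betw_inv_into_right[OF b i]
    by simp
qed

text \<open>Graph automorphisms thus form a section of \<open>index_perm\<close> over the
  label-preserving permutations, whence both the trivial intersection with the kernel and the
  factorization.\<close>

lemma index_perm_graph_aut: "\<alpha> \<in> label_perms \<Longrightarrow> i \<in> I \<Longrightarrow> index_perm (graph_aut n t \<alpha>) i = \<alpha> i"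
proof (rule index_perm_eq)
  assume \<alpha>: "\<alpha> \<in> label_perms" and i: "i \<in> I"
  have "graph_aut n t \<alpha> (a i) = conjg \<one>\<^bsub>W\<^esub> (a (\<alpha> i) [^]\<^bsub>W\<^esub> (1::int))"
    using graph_aut_a[OF \<alpha> i] a_closed[OF label_perms_in[OF \<alpha> i]] by simp
  then show "moves (graph_aut n t \<alpha>) i (\<alpha> i)" unfolding moves_def by blast
qed (simp_all only: graph_aut_in_A label_perms_in)

lemma graph_aut_mult:
  assumes \<alpha>: "\<alpha> \<in> label_perms" and \<beta>: "\<beta> \<in> label_perms"
  shows "\<alpha> \<circ> \<beta> \<in> label_perms" "graph_aut n t \<alpha> \<otimes>\<^bsub>A\<^esub> graph_aut n t \<beta> = graph_aut n t (\<alpha> \<circ> \<beta>)"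
proof -
  show c: "\<alpha> \<circ> \<beta> \<in> label_perms"
    using \<alpha> \<beta> label_perms_in[OF \<beta>] bij_betw_trans by (auto simp: label_perms_def simp del: atLeastAtMost_iff)
  show "graph_aut n t \<alpha> \<otimes>\<^bsub>A\<^esub> graph_aut n t \<beta> = graph_aut n t (\<alpha> \<circ> \<beta>)"
  proof (rule A_eqI)
    fix i assume i: "i \<in> I"
    show "(graph_aut n t \<alpha> \<otimes>\<^bsub>A\<^esub> graph_aut n t \<beta>) (a i) = graph_aut n t (\<alpha> \<circ> \<beta>) (a i)"
      using graph_aut_a[OF c i] graph_aut_a[OF \<beta> i] graph_aut_a[OF \<alpha> label_perms_in[OF \<beta> i]]
      by (simp add: A_apply graph_aut_in_A \<alpha> \<beta> a_closed[OF i])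
  qed (simp_all add: A_apply graph_aut_in_A graph_aut_w \<alpha> \<beta> c)
qed

lemma graph_aut_eq_one: "\<alpha> \<in> label_perms \<Longrightarrow> (\<And>i. i \<in> I \<Longrightarrow> \<alpha> i = i) \<Longrightarrow> graph_aut n t \<alpha> = \<one>\<^bsub>A\<^esub>"
  by (intro A_eqI) (simp_all add: graph_aut_in_A graph_aut_w graph_aut_a A_one del: atLeastAtMost_iff)

abbreviation "graph_auts \<equiv> graph_aut n t ` label_perms"

lemma graph_aut_inv:
  assumes \<alpha>: "\<alpha> \<in> label_perms"
  shows "inv\<^bsub>A\<^esub> (graph_aut n t \<alpha>) = graph_aut n t (inv_into I \<alpha>)"
proof (rule A.inv_equality)
  note \<beta> = label_perms_inv[OF \<alpha>]
  have b: "bij_betw \<alpha> I I" using \<alpha> by (simp add: label_perms_def)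
  have "graph_aut n t (inv_into I \<alpha> \<circ> \<alpha>) = \<one>\<^bsub>A\<^esub>"
    using bij_betw_inv_into_left[OF b] by (intro graph_aut_eq_one graph_aut_mult \<alpha> \<beta>) simp
  then show "graph_aut n t (inv_into I \<alpha>) \<otimes>\<^bsub>A\<^esub> graph_aut n t \<alpha> = \<one>\<^bsub>A\<^esub>"
    using graph_aut_mult(2)[OF \<beta> \<alpha>] by simp
qed (simp_all add: graph_aut_in_A \<alpha> label_perms_inv)

lemma one_in_graph_auts: "\<one>\<^bsub>A\<^esub> \<in> graph_auts"
proof -
  have "id \<in> label_perms" by (simp add: label_perms_def)
  then show ?thesis using graph_aut_eq_one[of id] by (metis id_apply imageI)
qed

lemma subgroup_graph_auts: "subgroup graph_auts A"
  using graph_aut_in_A graph_aut_mult graph_aut_inv label_perms_inv one_in_graph_auts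
  by (intro subgroup.intro) auto

lemma ker_inter_graph_auts: "ker \<inter> graph_auts = {\<one>\<^bsub>A\<^esub>}"
proof -
  have "\<phi> = \<one>\<^bsub>A\<^esub>" if \<phi>: "\<phi> \<in> ker" "\<phi> \<in> graph_auts" for \<phi>
  proof -
    obtain \<alpha> where \<alpha>: "\<alpha> \<in> label_perms" "\<phi> = graph_aut n t \<alpha>" using \<phi>(2) by (rule imageE)
    then show ?thesis using \<phi>(1) ker_iff index_perm_graph_aut graph_aut_eq_one by metis
  qed
  moreover have "\<one>\<^bsub>A\<^esub> \<in> ker"
    by (rule subgroup.one_closed[OF group_hom.subgroup_kernel[OF index_perm_hom]])
  ultimately show ?thesis using one_in_graph_auts by blast
qed

lemma ker_graph_auts: "ker <#>\<^bsub>A\<^esub> graph_auts = carrier A"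
proof
  show "ker <#>\<^bsub>A\<^esub> graph_auts \<subseteq> carrier A"
    using graph_aut_in_A by (auto simp: set_mult_def kernel_def)
  show "carrier A \<subseteq> ker <#>\<^bsub>A\<^esub> graph_auts"
  proof
    fix \<phi> assume \<phi>: "\<phi> \<in> carrier A"
    \<comment> \<open>Dividing \<open>\<phi>\<close> by the graph automorphism of its own index
      permutation leaves an element of the kernel.\<close>
    let ?\<alpha> = "index_perm \<phi>"
    have \<alpha>: "?\<alpha> \<in> label_perms"
      using index_perm_Bij[OF \<phi>] t_index_perm[OF \<phi>] by (simp add: label_perms_def Bij_def)
    note gr = graph_aut_in_A[OF \<alpha>]
    let ?\<psi> = "\<phi> \<otimes>\<^bsub>A\<^esub> inv\<^bsub>A\<^esub> (graph_aut n t ?\<alpha>)"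
    have \<psi>: "?\<psi> \<in> carrier A" using \<phi> gr by simp
    have "index_perm ?\<psi> i = i" if i: "i \<in> I" for i
    proof -
      have b: "bij_betw ?\<alpha> I I" using \<alpha> by (simp add: label_perms_def)
      note \<beta> = label_perms_inv[OF \<alpha>]
      have "index_perm ?\<psi> i = ?\<alpha> (index_perm (graph_aut n t (inv_into I ?\<alpha>)) i)"
        using index_perm_mult[OF \<phi> A.inv_closed[OF gr]] graph_aut_inv[OF \<alpha>] compose_eq[OF i] by simp
      then show ?thesis
        using index_perm_graph_aut[OF \<beta> i] bij_betw_inv_into_right[OF b i] by simp
    qed
    then have "?\<psi> \<in> ker" using ker_iff \<psi> by blast
    moreover have "\<phi> = ?\<psi> \<otimes>\<^bsub>A\<^esub> graph_aut n t ?\<alpha>"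
      using \<phi> gr by (simp add: A.m_assoc)
    ultimately show "\<phi> \<in> ker <#>\<^bsub>A\<^esub> graph_auts"
      unfolding set_mult_def using \<alpha> by blast
  qed
qed

end

subsection \<open>Blocks and labels\<close>

lemma sum_list_take_mono: "i \<le> j \<Longrightarrow> sum_list (take i ks) \<le> sum_list (take j (ks :: nat list))"
proof -
  assume "i \<le> j"
  then have "take j ks = take i ks @ take (j - i) (drop i ks)"
    by (metis le_add_diff_inverse take_add)
  then show ?thesis by simp
qed

lemma block_ex:
  assumes "i \<in> {2..1 + sum_list ks}"
  obtains j where "j < length ks" "i \<in> block ks j"
proof -
  \<comment> \<open>The least \<open>j\<close> counts the blocks up to and including the one that
    contains \<open>i\<close>, so that block has index \<open>j - 1\<close>; \<open>j = 0\<close> is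
    excluded by \<open>2 \<le> i\<close>.\<close>
  define j where "j = (LEAST j. i \<le> 1 + sum_list (take j ks))"
  have ex: "i \<le> 1 + sum_list (take (length ks) ks)" using assms by simp
  have j: "i \<le> 1 + sum_list (take j ks)" "j \<le> length ks"
    using LeastI[of "\<lambda>j. i \<le> 1 + sum_list (take j ks)", OF ex] Least_le[of "\<lambda>j. i \<le> 1 + sum_list (take j ks)", OF ex]
    unfolding j_def by auto
  then obtain j' where j': "j = Suc j'" using assms by (cases j) auto
  then have "\<not> i \<le> 1 + sum_list (take j' ks)" using not_less_Least[of j' "\<lambda>j. i \<le> 1 + sum_list (take j ks)"] unfolding j_def by simp
  then show ?thesis using that[of j'] j j' by (simp add: block_def)
qed

lemma block_unique: "i \<in> block ks j \<Longrightarrow> i \<in> block ks j' \<Longrightarrow> j = j'"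
proof (induction j j' rule: linorder_wlog)
  case (le j j')
  then show ?case
    using sum_list_take_mono[of "Suc j" j' ks] by (cases "j = j'") (auto simp: block_def)
qed auto

lemma block_subset: "block ks j \<subseteq> {2..1 + sum_list ks}"
  using sum_list_take_mono[of "Suc j" "Suc j + length ks" ks] by (auto simp: block_def)

lemma label_eq: "j < length ks \<Longrightarrow> i \<in> block ks j \<Longrightarrow> label ks ms i = ms ! j"
  unfolding label_def using block_unique by (metis (mono_tags, lifting) the_equality)

text \<open>As \<open>ms\<close> is distinct, a label determines its block, so a label-preserving
  \<open>\<alpha>\<close> maps each block into itself; injectivity and finiteness give
  equality.\<close>

lemma blocks_preserved_iff:
  assumes "length ms = length ks" "distinct ms"
    and \<alpha>: "bij_betw \<alpha> {2..1 + sum_list ks} {2..1 + sum_list ks}"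
  shows "(\<forall>j < length ks. \<alpha> ` block ks j = block ks j)
     \<longleftrightarrow> (\<forall>i\<in>{2..1 + sum_list ks}. label ks ms (\<alpha> i) = label ks ms i)"
proof safe
  fix i assume p: "\<forall>j < length ks. \<alpha> ` block ks j = block ks j" and i: "i \<in> {2..1 + sum_list ks}"
  obtain j where "j < length ks" "i \<in> block ks j" using block_ex[OF i] .
  moreover from this have "\<alpha> i \<in> block ks j" using p by blast
  ultimately show "label ks ms (\<alpha> i) = label ks ms i" by (simp add: label_eq)
next
  assume l: "\<forall>i\<in>{2..1 + sum_list ks}. label ks ms (\<alpha> i) = label ks ms i"
  have eq: "\<alpha> ` block ks j = block ks j" if j: "j < length ks" for j
  proof (rule card_subset_eq)
    show "finite (block ks j)" by (simp add: block_def)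
    show "\<alpha> ` block ks j \<subseteq> block ks j"
    proof
      fix x assume "x \<in> \<alpha> ` block ks j"
      then obtain i where i: "i \<in> block ks j" "x = \<alpha> i" by blast
      have I: "i \<in> {2..1 + sum_list ks}" using i block_subset by blast
      then have "\<alpha> i \<in> {2..1 + sum_list ks}" using bij_betwE[OF \<alpha>] by blast
      then obtain j' where j': "j' < length ks" "\<alpha> i \<in> block ks j'" using block_ex by blast
      have "ms ! j' = ms ! j" using l I i j j' label_eq by metis
      then have "j' = j" using assms j j' by (simp add: nth_eq_iff_index_eq)
      then show "x \<in> block ks j" using i j' by simp
    qed
    show "card (\<alpha> ` block ks j) = card (block ks j)"
      using \<alpha> block_subset by (intro card_image) (metis bij_betw_def inj_on_subset)
  qed
  fix j x assume j: "j < length ks"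
  {
    assume "x \<in> block ks j"
    then show "\<alpha> x \<in> block ks j" using eq[OF j] by blast
  }
  {
    assume "x \<in> block ks j"
    then show "x \<in> \<alpha> ` block ks j" using eq[OF j] by blast
  }
qed

theorem theorem3p6:
  fixes n :: nat and ms ks :: "nat list"
  assumes "n \<ge> 3"
    and "length ms = length ks"
    and "distinct ms"
    and "\<forall>m \<in> set ms. odd m \<and> m \<ge> 3"
    and "\<forall>k \<in> set ks. k > 0"
    and "sum_list ks = n - 1"
  defines "W \<equiv> StarGroup n (label ks ms)"
    and "InnC \<equiv> inner_auts (StarGroup n (label ks ms))
                 <#>\<^bsub>AutoGroup (StarGroup n (label ks ms))\<^esub> Csub n (label ks ms)"
    and "G \<equiv> Gsub n ks ms"
  shows "InnC \<lhd> AutoGroup W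
       \<and> subgroup G (AutoGroup W)
       \<and> InnC \<inter> G = {\<one>\<^bsub>AutoGroup W\<^esub>}
       \<and> InnC <#>\<^bsub>AutoGroup W\<^esub> G = carrier (AutoGroup W)"
proof -
  have n: "n = 1 + sum_list ks" using assms(1,6) by simp
  have label: "odd (label ks ms i) \<and> label ks ms i \<ge> 3" if i: "i \<in> {2..n}" for i
  proof -
    obtain j where j: "j < length ks" "i \<in> block ks j" using i block_ex unfolding n by blast
    then have "label ks ms i \<in> set ms" using assms(2) by (simp add: label_eq)
    then show ?thesis using assms(4) by blast
  qed
  interpret S: odd_star_group n "label ks ms"
    using assms(1) label by unfold_locales auto
  \<comment> \<open>\<open>Gsub\<close> is phrased with blocks and \<open>S.graph_auts\<close> with
    labels; both admit the same permutations.\<close>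
  have G: "G = S.graph_auts"
    using blocks_preserved_iff[OF assms(2,3)]
    unfolding G_def Gsub_def S.label_perms_def n[symmetric] image_def by blast
  show ?thesis
    unfolding InnC_def W_def G S.ker_eq
    using group_hom.normal_kernel[OF S.index_perm_hom] S.subgroup_graph_auts
      S.ker_inter_graph_auts S.ker_graph_auts by blast
qed

end
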